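(* Let $q$ be a prime power and $r\ge1$ an integer. For Haar-almost every $(\alpha_1,\ldots,\alpha_r)\in\mathfrak p^r$, where $\mathfrak p=t^{-1}\mathbb F_q[[t^{-1}]]$, $$\lim_{D\to\infty}\frac1D\,\#\{j:d^{(r)}_j\le D\}=\frac{1-q^{-r}}{r}.$$ Equivalently, for Haar-almost every $(\alpha_1,\ldots,\alpha_r)\in\mathfrak p^r$, $$\lim_{j\to\infty}\frac{d^{(r)}_j}{j}=\frac{r}{1-q^{-r}}=\frac{rq^r}{q^r-1}.$$
   Context: $\mathfrak p=t^{-1}\mathbb F_q[[t^{-1}]]\subset\mathbb F_q((t^{-1}))$, and $\mathfrak p^r$ carries product Haar probability measure. For $x\in\mathbb F_q((t^{-1}))$ the cancellation length $c(x)$ is the largest $n\ge0$ such that the coefficients of $t^{-1},\ldots,t^{-n}$ in $x$ all vanish ($c(x)=\infty$ if all negative coefficients vanish). For nonzero $Q\in\mathbb F_q[t]$, $d(Q)=\deg Q+1$. For $n\ge0$, $$L_r(n)=\min\{d(Q):0\ne Q\in\mathbb F_q[t],\ c(Q\alpha_i)\ge n\text{ for all }1\le i\le r\}.$$ $d^{(r)}_1<d^{(r)}_2<\cdots$ is the increasing list of the distinct values of $L_r(n)$, $n\ge0$; this list is infinite for Haar-almost every $(\alpha_1,\ldots,\alpha_r)$. *)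

theory Defs
  imports "HOL-Probability.Probability" "HOL-Computational_Algebra.Computational_Algebra"
begin

text \<open>
  A Laurent series over \<open>'a\<close> in the library variable \<open>X\<close> is read as an element of
  \<open>F((t\<^sup>-\<^sup>1))\<close> with \<open>X = t\<^sup>-\<^sup>1\<close>: the coefficient of \<open>t ^ (-k)\<close> in \<open>x\<close> is \<open>fls_nth x k\<close>, and
  \<open>t\<close> itself is \<^const>\<open>fls_X_inv\<close>.
\<close>

definition poly_in_t :: "'a::field poly \<Rightarrow> 'a fls" where
  "poly_in_t Q = poly (map_poly fls_const Q) fls_X_inv"

definition fls_frac :: "'a::field fls set" where
  "fls_frac = range (\<lambda>f. fls_X * fps_to_fls f)"

text \<open>
  The topology is the one carried by the ambient type; on \<^typ>\<open>'a fls\<close> this is the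
  \<open>X\<close>-adic topology.
\<close>

definition haar_probability :: "'a::{topological_space,group_add} set \<Rightarrow> 'a measure \<Rightarrow> bool" where
  "haar_probability G \<mu> \<longleftrightarrow>
     prob_space \<mu> \<and> sets \<mu> = sets (restrict_space borel G) \<and>
     (\<forall>x\<in>G. distr \<mu> \<mu> (\<lambda>y. x + y) = \<mu>)"

definition cancellation_length :: "'a::field fls \<Rightarrow> enat" where
  "cancellation_length x = Sup {enat n | n. \<forall>k\<in>{1..n}. fls_nth x (int k) = 0}"

definition poly_length :: "'a::field poly \<Rightarrow> nat" where
  "poly_length Q = degree Q + 1"

text \<open>
  The minimum is over a nonempty set: a polynomial of degree \<open>r * n\<close> has more
  coefficients than there are linear conditions.
\<close>

definition min_length :: "nat \<Rightarrow> (nat \<Rightarrow> 'a::field fls) \<Rightarrow> nat \<Rightarrow> nat" where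
  "min_length r \<alpha> n =
     (LEAST d. \<exists>Q. Q \<noteq> 0 \<and> (\<forall>i\<in>{1..r}. cancellation_length (poly_in_t Q * \<alpha> i) \<ge> enat n) \<and>
                   d = poly_length Q)"

text \<open>
  Indexed from \<open>j = 1\<close>; meaningful when the set of values is infinite, which holds almost
  everywhere.  (\<^const>\<open>enumerate\<close> starts at 0.)
\<close>

definition length_value :: "nat \<Rightarrow> (nat \<Rightarrow> 'a::field fls) \<Rightarrow> nat \<Rightarrow> nat" where
  "length_value r \<alpha> j = enumerate (range (min_length r \<alpha>)) (j - 1)"

text \<open>
  Existence of a Haar probability measure on \<^const>\<open>fls_frac\<close>: the image of the product of
  uniform measures on the coefficients.
\<close>

lemma open_fls_ballE:
  fixes S :: "'a::field fls set"
  assumes "open S" "x \<in> S"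
  obtains n :: nat where "\<And>y. (\<And>k. k < int n \<Longrightarrow> fls_nth y k = fls_nth x k) \<Longrightarrow> y \<in> S"
proof -
  obtain e where e: "e > 0" "ball x e \<subseteq> S"
    using assms open_contains_ball by blast
  obtain n :: nat where n: "inverse (2 ^ n) < e"
    using real_arch_pow_inv[of e "1/2"] e(1) by (auto simp: power_one_over inverse_eq_divide)
  have "y \<in> S" if y: "\<And>k. k < int n \<Longrightarrow> fls_nth y k = fls_nth x k" for y
  proof (cases "x = y")
    case True
    with assms show ?thesis by simp
  next
    case False
    have "fls_subdegree (x - y) \<ge> int n"
      using False y by (intro fls_subdegree_geI) auto
    hence "dist x y = inverse (2 ^ nat (fls_subdegree (x - y)))"
      using False by (simp add: dist_fls_def)
    also have "\<dots> \<le> inverse (2 ^ n)"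
      using \<open>fls_subdegree (x - y) \<ge> int n\<close>
      by (intro le_imp_inverse_le power_increasing) auto
    finally show ?thesis using n e by auto
  qed
  with that show ?thesis by blast
qed

lemma haar_probability_exists:
  "\<exists>\<mu>. haar_probability (fls_frac :: 'a::{field,finite} fls set) \<mu>"
proof -
  define U where "U = uniform_count_measure (UNIV :: 'a set)"
  define N where "N = (\<Pi>\<^sub>M n\<in>(UNIV :: nat set). U)"
  define G where "G = (fls_frac :: 'a fls set)"
  define B where "B = restrict_space borel G"
  define g where "g = (\<lambda>f :: nat \<Rightarrow> 'a. fls_X * fps_to_fls (Abs_fps f))"
  have U: "prob_space U" "sets U = UNIV" "space U = UNIV"
    unfolding U_def
    by (auto intro!: prob_space_uniform_count_measure
        simp: sets_uniform_count_measure space_uniform_count_measure)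
  interpret U: prob_space U by fact
  interpret P: product_prob_space "\<lambda>_::nat. U" UNIV by unfold_locales
  interpret N: prob_space N
    unfolding N_def by (intro prob_space_PiM U)
  have space_N: "space N = UNIV"
    by (simp add: N_def space_PiM U)
  have nth_g: "fls_nth (g f) k = (if k \<ge> 1 then f (nat (k - 1)) else 0)" for f k
    by (auto simp: g_def fls_X_times_conv_shift)
  have g_in: "g f \<in> G" for f
    by (auto simp: g_def G_def fls_frac_def)
  have g_surj: "\<exists>f. x = g f" if "x \<in> G" for x
    using that by (auto simp: g_def G_def fls_frac_def) (metis fps_nth_inverse)
  have g_add: "g a + g f = g (\<lambda>i. a i + f i)" for a f
    by (rule fls_eqI) (simp add: nth_g)
  have G_add: "x + y \<in> G" if "x \<in> G" "y \<in> G" for x y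
    using that g_surj g_add g_in by metis
  define cyl where "cyl = (\<lambda>l :: 'a list. {f :: nat \<Rightarrow> 'a. \<forall>i<length l. f i = l ! i})"
  have cyl: "cyl l \<in> sets N" for l
  proof -
    have "{f \<in> space N. \<forall>i\<in>{..<length l}. f i \<in> {l ! i}} \<in> sets N"
      unfolding N_def
    proof (intro sets.sets_Collect_finite_All)
      fix i
      show "{f \<in> space (\<Pi>\<^sub>M n\<in>(UNIV :: nat set). U). f i \<in> {l ! i}} \<in> sets (\<Pi>\<^sub>M n\<in>(UNIV :: nat set). U)"
        by (rule sets_Collect_single') (auto simp: U)
    qed auto
    thus ?thesis by (simp add: cyl_def space_N Ball_def)
  qed
  have g_open: "g -` S \<in> sets N" if S: "open S" for S
  proof -
    have "g -` S = (\<Union>l\<in>{l. cyl l \<subseteq> g -` S}. cyl l)"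
    proof (intro equalityI subsetI)
      fix f assume f: "f \<in> g -` S"
      obtain n where n: "\<And>y. (\<And>k. k < int n \<Longrightarrow> fls_nth y k = fls_nth (g f) k) \<Longrightarrow> y \<in> S"
        using open_fls_ballE[OF S, of "g f"] f by auto
      have "cyl (map f [0..<n]) \<subseteq> g -` S"
        by (auto simp: cyl_def nth_g intro!: n)
      moreover have "f \<in> cyl (map f [0..<n])"
        by (simp add: cyl_def)
      ultimately show "f \<in> (\<Union>l\<in>{l. cyl l \<subseteq> g -` S}. cyl l)"
        by blast
    qed auto
    also have "\<dots> \<in> sets N"
      using cyl by (intro sets.countable_UN') auto
    finally show ?thesis .
  qed
  have g_meas: "g \<in> measurable N B"
    unfolding B_def
  proof (rule measurable_restrict_space2)
    show "g \<in> borel_measurable N"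
      by (rule borel_measurableI) (simp add: space_N g_open)
  qed (use g_in in auto)
  define \<mu> where "\<mu> = distr N B g"
  have shift_meas: "(\<lambda>f i. a i + f i) \<in> measurable N N" for a
    unfolding N_def
  proof (rule measurable_PiM_single')
    fix i
    have "(\<lambda>x. a i + x) \<in> measurable U U" by (auto simp: measurable_def U)
    thus "(\<lambda>f. a i + f i) \<in> measurable (\<Pi>\<^sub>M n\<in>(UNIV :: nat set). U) U"
      by (rule measurable_compose[rotated]) measurable
  qed (auto simp: U)
  have shift_U: "emeasure U ((\<lambda>x. b + x) -` A) = emeasure U A" for b A
  proof -
    have "bij (\<lambda>x::'a. b + x)"
      by (rule bij_betw_byWitness[where f' = "\<lambda>x. x - b"]) auto
    hence "card ((\<lambda>x. b + x) -` A) = card A"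
      by (rule card_vimage_inj[OF bij_is_inj]) (auto simp: bij_is_surj)
    thus ?thesis
      unfolding U_def by (simp add: emeasure_uniform_count_measure)
  qed
  have shift_N: "distr N N (\<lambda>f i. a i + f i) = N" for a
  proof (rule measure_eqI_PiM_infinite)
    show "finite_measure (distr N N (\<lambda>f i. a i + f i))"
      using N.prob_space_distr[OF shift_meas] by (simp add: prob_space.finite_measure)
    fix A :: "nat \<Rightarrow> 'a set" and J :: "nat set"
    assume J: "finite J" "J \<subseteq> UNIV" "\<And>i. i \<in> J \<Longrightarrow> A i \<in> sets U"
    let ?E = "\<lambda>A. prod_emb UNIV (\<lambda>_::nat. U) J (Pi\<^sub>E J A)"
    have E: "?E A \<in> sets N" for A
      unfolding N_def using J by (intro sets_PiM_I) (auto simp: U)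
    have "(\<lambda>f i. a i + f i) -` ?E A \<inter> space N = ?E (\<lambda>i. (\<lambda>x. a i + x) -` A i)"
      by (auto simp: prod_emb_def space_N U PiE_def Pi_def)
    hence "emeasure (distr N N (\<lambda>f i. a i + f i)) (?E A) =
             emeasure N (?E (\<lambda>i. (\<lambda>x. a i + x) -` A i))"
      using E shift_meas by (simp add: emeasure_distr)
    also have "\<dots> = (\<Prod>i\<in>J. emeasure U ((\<lambda>x. a i + x) -` A i))"
      unfolding N_def using J by (intro P.emeasure_PiM_emb) (auto simp: U)
    also have "\<dots> = emeasure N (?E A)"
      unfolding N_def shift_U using J by (intro P.emeasure_PiM_emb[symmetric]) auto
    finally show "emeasure (distr N N (\<lambda>f i. a i + f i)) (?E A) = emeasure N (?E A)" .
  qed (simp_all add: N_def)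
  have sets_\<mu>: "sets \<mu> = sets B" by (simp add: \<mu>_def)
  have shift_B: "(\<lambda>y. x + y) \<in> measurable B B" if "x \<in> G" for x
  proof -
    have "continuous_on UNIV (\<lambda>y :: 'a fls. x + y)"
      by (intro continuous_onI) (auto simp: dist_fls_def)
    hence "(\<lambda>y. x + y) \<in> borel_measurable borel"
      by (rule borel_measurable_continuous_onI)
    thus ?thesis
      unfolding B_def using that G_add
      by (intro measurable_restrict_space3) auto
  qed
  have "distr \<mu> \<mu> (\<lambda>y. x + y) = \<mu>" if x: "x \<in> G" for x
  proof -
    obtain a where a: "x = g a" using g_surj x by blast
    have "distr \<mu> \<mu> (\<lambda>y. x + y) = distr \<mu> B (\<lambda>y. x + y)"
      by (intro distr_cong) (auto simp: sets_\<mu>)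
    also have "\<dots> = distr N B ((\<lambda>y. x + y) \<circ> g)"
      unfolding \<mu>_def by (rule distr_distr[OF shift_B[OF x] g_meas])
    also have "(\<lambda>y. x + y) \<circ> g = g \<circ> (\<lambda>f i. a i + f i)"
      by (auto simp: a g_add)
    also have "distr N B \<dots> = distr (distr N N (\<lambda>f i. a i + f i)) B g"
      by (rule distr_distr[OF g_meas shift_meas, symmetric])
    finally show ?thesis by (simp add: shift_N \<mu>_def)
  qed
  moreover have "prob_space \<mu>"
    unfolding \<mu>_def by (rule N.prob_space_distr[OF g_meas])
  ultimately have "haar_probability G \<mu>"
    by (simp add: haar_probability_def sets_\<mu> B_def)
  thus ?thesis by (auto simp: G_def)
qed

end

theory Submission
  imports Defs "HOL-Probability.Hoeffding" "HOL-Real_Asymp.Real_Asymp"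
begin

text \<open>
  Write \<open>L n\<close> for \<^const>\<open>min_length\<close> \<open>r \<alpha> n\<close>.  It is a nondecreasing sequence, so its distinct
  values up to \<open>L N\<close> correspond to the indices \<open>n < N\<close> at which it increases, plus the initial
  value.  The theorem follows from two almost sure facts: \<open>L N / N\<close> tends to \<open>r\<close>
  (\<open>AE_min_length_growth\<close>), and \<open>L\<close> stagnates, \<open>L (n + 1) = L n\<close>, for a proportion \<open>q ^ (-r)\<close> of
  all \<open>n\<close> (\<open>AE_stagnation_frequency\<close>).  The \<open>j\<close>-th value is then reached near
  \<open>N = j / (1 - q ^ (-r))\<close> and has size about \<open>r * N\<close>.

  The second fact is the heart of the matter: the stagnation events are independent, each of
  probability exactly \<open>q ^ (-r)\<close>.  At stage \<open>n\<close> there is a unique monic polynomial \<open>Q\<close> of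
  minimal length with \<open>c (Q * \<alpha> i) \<ge> n\<close> for all \<open>i\<close>, and \<open>L\<close> stagnates at \<open>n\<close> if and only if the
  same \<open>Q\<close> still works at stage \<open>n + 1\<close>.  Both \<open>Q\<close> and the whole history \<open>L 0, \<dots>, L n\<close> depend only
  on the coefficients of the \<open>\<alpha> i\<close> with index less than \<open>n + L n\<close>, whereas coefficient \<open>n + 1\<close> of
  \<open>Q * \<alpha> i\<close> is the coefficient of \<open>\<alpha> i\<close> with index \<open>n + L n\<close> plus something determined by the
  history.  Hence, given the history, the \<open>r\<close> new coefficients are independent and uniform, and all
  vanish with probability \<open>q ^ (-r)\<close> (\<open>prob_history_stagnation\<close>).  The strong law of large numbers
  for independent events then gives the frequency.

  For the first fact, \<open>L N \<le> r * N + 1\<close> by counting dimensions, and a union bound over all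
  polynomials of small degree, each of which is admissible with probability \<open>q ^ (- r * N)\<close>, shows
  that \<open>L N\<close> falls short of \<open>r * N\<close> by more than a multiple of \<open>ln N\<close> only finitely often.

  All probabilities come from translation invariance of the Haar measure (\<open>equidistribution\<close>).
\<close>

section \<open>Polynomials in t acting on Laurent series\<close>

lemma mem_fls_frac_iff: "x \<in> fls_frac \<longleftrightarrow> (\<forall>k\<le>0. fls_nth x k = 0)"
proof
  assume *: "\<forall>k\<le>0. fls_nth x k = 0"
  have "x = fls_X * fps_to_fls (Abs_fps (\<lambda>n. fls_nth x (int n + 1)))"
    by (rule fls_eqI) (use * in \<open>auto simp: fls_X_times_conv_shift\<close>)
  thus "x \<in> fls_frac" unfolding fls_frac_def by blast
qed (auto simp: fls_frac_def fls_X_times_conv_shift)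

lemma poly_in_t_altdef:
  "poly_in_t Q = (\<Sum>m\<le>degree Q. fls_const (coeff Q m) * fls_X_inv ^ m)"
proof -
  have "degree (map_poly fls_const Q) = degree Q"
    by (cases "Q = 0") (auto intro!: map_poly_degree_eq simp: fls_const_nonzero)
  thus ?thesis
    unfolding poly_in_t_def poly_altdef by (simp add: coeff_map_poly)
qed

lemma nth_poly_in_t_mult:
  "fls_nth (poly_in_t Q * x) k = (\<Sum>m\<le>degree Q. coeff Q m * fls_nth x (k + int m))"
proof -
  have "fls_nth (fls_const c * fls_X_inv ^ m * x) k = c * fls_nth x (k + int m)" for c m
    using arg_cong[OF fls_X_inv_power_times_conv_shift(1)[of m x],
        of "\<lambda>y. fls_nth (fls_const c * y) k"] by (simp add: mult.assoc)
  thus ?thesis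
    unfolding poly_in_t_altdef by (simp add: sum_distrib_right fls_nth_sum)
qed

lemma nth_poly_in_t_mult_bound:
  assumes "degree Q \<le> d"
  shows "fls_nth (poly_in_t Q * x) k = (\<Sum>m\<le>d. coeff Q m * fls_nth x (k + int m))"
  unfolding nth_poly_in_t_mult
  using assms by (intro sum.mono_neutral_left) (auto simp: coeff_eq_0)

lemma poly_in_t_diff: "poly_in_t (P - Q) = poly_in_t P - poly_in_t Q"
proof (rule fls_eqI)
  fix k
  let ?d = "max (degree P) (degree Q)"
  have d: "degree P \<le> ?d" "degree Q \<le> ?d" "degree (P - Q) \<le> ?d"
    by (auto intro: degree_diff_le)
  show "fls_nth (poly_in_t (P - Q)) k = fls_nth (poly_in_t P - poly_in_t Q) k"
    \<comment> \<open>The product formula with the factor 1 reads off the coefficients of \<open>poly_in_t\<close> itself.\<close>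
    using nth_poly_in_t_mult_bound[OF d(1), of 1 k] nth_poly_in_t_mult_bound[OF d(2), of 1 k]
      nth_poly_in_t_mult_bound[OF d(3), of 1 k]
    by (simp add: sum_subtractf left_diff_distrib)
qed

lemma poly_in_t_smult: "poly_in_t (smult c Q) = fls_const c * poly_in_t Q"
proof (rule fls_eqI)
  fix k
  show "fls_nth (poly_in_t (smult c Q)) k = fls_nth (fls_const c * poly_in_t Q) k"
    using nth_poly_in_t_mult_bound[of "smult c Q" "degree Q" 1 k] nth_poly_in_t_mult[of Q 1 k]
      degree_smult_le[of c Q]
    by (simp add: sum_distrib_left mult.assoc del: degree_smult_eq)
qed

lemma subdegree_poly_in_t:
  assumes "Q \<noteq> 0"
  shows "poly_in_t Q \<noteq> 0" "fls_subdegree (poly_in_t Q) = - int (degree Q)"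
proof -
  have nth: "fls_nth (poly_in_t Q) k = (\<Sum>m\<le>degree Q. coeff Q m * (if k + int m = 0 then 1 else 0))" for k
    using nth_poly_in_t_mult[of Q 1 k] by simp
  have top: "fls_nth (poly_in_t Q) (- int (degree Q)) = lead_coeff Q"
  proof -
    have "(\<Sum>m\<le>degree Q. coeff Q m * (if - int (degree Q) + int m = 0 then 1 else 0)) =
          (\<Sum>m\<le>degree Q. if m = degree Q then coeff Q m else 0)"
      by (intro sum.cong) auto
    thus ?thesis unfolding nth by simp
  qed
  show "fls_subdegree (poly_in_t Q) = - int (degree Q)"
    by (rule fls_subdegree_eqI) (use top assms in \<open>auto simp: nth intro!: sum.neutral\<close>)
  show "poly_in_t Q \<noteq> 0" using top assms by auto
qed

text \<open>
  The quotient \<open>V / Q\<close> in the field of Laurent series.  Its first non-zero coefficient sits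
  \<open>degree Q\<close> places later than that of \<open>V\<close>; this is what makes it possible to change late
  coefficients of \<open>Q * x\<close> by changing only late coefficients of \<open>x\<close>.
\<close>

lemma ex_poly_in_t_mult_eq:
  assumes "Q \<noteq> 0" "\<And>k. k < int m \<Longrightarrow> fls_nth V k = 0"
  obtains b where "poly_in_t Q * b = V" "\<And>k. k < int (m + degree Q) \<Longrightarrow> fls_nth b k = 0"
proof
  let ?b = "V / poly_in_t Q"
  note Q = subdegree_poly_in_t[OF assms(1)]
  show "poly_in_t Q * ?b = V" using Q(1) by simp
  fix k assume k: "k < int (m + degree Q)"
  show "fls_nth ?b k = 0"
  proof (cases "V = 0")
    case False
    hence "int m \<le> fls_subdegree V" using assms(2) by (intro fls_subdegree_geI) auto
    hence "k < fls_subdegree ?b" using k Q False by (simp add: fls_divide_subdegree)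
    thus ?thesis by simp
  qed simp
qed

lemma le_cancellation_length_iff:
  "enat n \<le> cancellation_length x \<longleftrightarrow> (\<forall>k\<in>{1..n}. fls_nth x (int k) = 0)"
proof
  assume le: "enat n \<le> cancellation_length x"
  show "\<forall>k\<in>{1..n}. fls_nth x (int k) = 0"
  proof
    fix k assume k: "k \<in> {1..n}"
    show "fls_nth x (int k) = 0"
    proof (rule ccontr)
      assume nz: "fls_nth x (int k) \<noteq> 0"
      have "cancellation_length x \<le> enat (k - 1)"
        unfolding cancellation_length_def
      proof (rule Sup_least)
        fix e assume "e \<in> {enat n | n. \<forall>k\<in>{1..n}. fls_nth x (int k) = 0}"
        then obtain j where j: "e = enat j" "\<forall>k\<in>{1..j}. fls_nth x (int k) = 0" by blast
        hence "j < k" using nz k by (meson atLeastAtMost_iff not_le)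
        thus "e \<le> enat (k - 1)" using j by simp
      qed
      with le have "n \<le> k - 1" by (meson enat_ord_simps(1) order_trans)
      with k show False by auto
    qed
  qed
qed (auto simp: cancellation_length_def intro!: Sup_upper)

section \<open>Minimal polynomials of the approximation problem\<close>

text \<open>
  Multiplying by a polynomial in \<open>t\<close> is linear in the polynomial, so for fixed \<open>\<alpha>\<close> and \<open>n\<close> the
  admissible polynomials (together with 0) form a vector space.
\<close>

definition cancels :: "nat \<Rightarrow> (nat \<Rightarrow> 'a::field fls) \<Rightarrow> nat \<Rightarrow> 'a poly \<Rightarrow> bool" where
  "cancels r \<alpha> n Q \<longleftrightarrow> (\<forall>i\<in>{1..r}. \<forall>k\<in>{1..n}. fls_nth (poly_in_t Q * \<alpha> i) (int k) = 0)"

lemma min_length_altdef: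
  "min_length r \<alpha> n = (LEAST d. \<exists>Q. Q \<noteq> 0 \<and> cancels r \<alpha> n Q \<and> d = poly_length Q)"
  by (simp add: min_length_def cancels_def le_cancellation_length_iff)

lemma cancels_mono: "cancels r \<alpha> n Q \<Longrightarrow> m \<le> n \<Longrightarrow> cancels r \<alpha> m Q"
  by (auto simp: cancels_def)

text \<open>
  The new condition is kept as a statement about the one-element block \<open>{n+1..n+1}\<close> of
  coefficients, the form in which equidistribution of blocks is proved below.
\<close>

lemma cancels_Suc:
  "cancels r \<alpha> (Suc n) Q \<longleftrightarrow>
     cancels r \<alpha> n Q \<and> (\<forall>i\<in>{1..r}. \<forall>k\<in>{n+1..n+1}. fls_nth (poly_in_t Q * \<alpha> i) (int k) = 0)"
proof -
  have "{1..Suc n} = insert (n+1) {1..n}" by auto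
  thus ?thesis unfolding cancels_def by auto
qed

lemma cancels_diff: "cancels r \<alpha> n P \<Longrightarrow> cancels r \<alpha> n Q \<Longrightarrow> cancels r \<alpha> n (P - Q)"
  by (auto simp: cancels_def poly_in_t_diff left_diff_distrib)

lemma cancels_smult: "cancels r \<alpha> n Q \<Longrightarrow> cancels r \<alpha> n (smult c Q)"
  by (auto simp: cancels_def poly_in_t_smult mult.assoc)

text \<open>
  The vector space of polynomials of length at most \<open>d\<close>.  Bounding the coefficients and not
  \<^const>\<open>poly_length\<close> keeps the zero polynomial inside also for \<open>d = 0\<close>, and gives exactly
  \<open>q ^ d\<close> elements.
\<close>

definition polys_below :: "nat \<Rightarrow> 'a::zero poly set" where
  "polys_below d = {Q. \<forall>k\<ge>d. coeff Q k = 0}"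

lemma polys_below_iff: "Q \<noteq> 0 \<Longrightarrow> Q \<in> polys_below d \<longleftrightarrow> poly_length Q \<le> d"
  by (auto simp: polys_below_def poly_length_def Suc_le_eq coeff_eq_0)
     (meson leading_coeff_0_iff not_le)

lemma bij_polys_below:
  "bij_betw (\<lambda>Q. restrict (coeff Q) {..<d}) (polys_below d)
     (PiE {..<d} (\<lambda>_. UNIV :: 'a::zero set))"
proof (rule bij_betwI')
  fix P Q :: "'a poly" assume *: "P \<in> polys_below d" "Q \<in> polys_below d"
  show "(restrict (coeff P) {..<d} = restrict (coeff Q) {..<d}) = (P = Q)"
  proof
    assume eq: "restrict (coeff P) {..<d} = restrict (coeff Q) {..<d}"
    show "P = Q"
    proof (rule poly_eqI)
      fix k
      show "coeff P k = coeff Q k"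
        using fun_cong[OF eq, of k] * by (cases "k < d") (auto simp: polys_below_def)
    qed
  qed auto
next
  fix f :: "nat \<Rightarrow> 'a" assume f: "f \<in> PiE {..<d} (\<lambda>_. UNIV)"
  let ?Q = "Poly (map f [0..<d])"
  have "coeff ?Q k = (if k < d then f k else 0)" for k
    by (simp add: nth_default_def)
  hence "?Q \<in> polys_below d" "f = restrict (coeff ?Q) {..<d}"
    using f by (auto simp: polys_below_def fun_eq_iff PiE_def extensional_def)
  thus "\<exists>Q\<in>polys_below d. f = restrict (coeff Q) {..<d}" by blast
qed auto

lemma finite_polys_below: "finite (polys_below d :: 'a::{finite,zero} poly set)"
  and card_polys_below: "card (polys_below d :: 'a poly set) = CARD('a) ^ d"
proof -
  note bij = bij_polys_below[where 'a = 'a and d = d]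
  have "finite (PiE {..<d} (\<lambda>_. UNIV :: 'a set))" by (intro finite_PiE) auto
  thus "finite (polys_below d :: 'a poly set)" using bij_betw_finite[OF bij] by blast
  show "card (polys_below d :: 'a poly set) = CARD('a) ^ d"
    using bij_betw_same_card[OF bij] by (simp add: card_PiE)
qed

lemma card_field_ge_2: "CARD('a::{field,finite}) \<ge> 2"
proof -
  have "card {0, 1 :: 'a} \<le> CARD('a)" by (rule card_mono) auto
  thus ?thesis by simp
qed

text \<open>
  Pigeonhole: there are \<open>q ^ (r * n + 1)\<close> polynomials of degree at most \<open>r * n\<close>, but only
  \<open>q ^ (r * n)\<close> possible blocks of \<open>r * n\<close> coefficients, so two polynomials produce the same
  block and their difference is admissible.
\<close>

lemma ex_cancels:
  fixes \<alpha> :: "nat \<Rightarrow> 'a::{field,finite} fls"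
  shows "\<exists>Q. Q \<noteq> 0 \<and> cancels r \<alpha> n Q \<and> poly_length Q \<le> r * n + 1"
proof -
  let ?d = "r * n + 1"
  let ?I = "{1..r} \<times> {1..n}"
  define v where "v = (\<lambda>Q. \<lambda>(i,k)\<in>?I. fls_nth (poly_in_t Q * \<alpha> i) (int k))"
  have "\<not> inj_on v (polys_below ?d)"
  proof
    assume inj: "inj_on v (polys_below ?d)"
    have fin: "finite (PiE ?I (\<lambda>_. UNIV :: 'a set))" by (intro finite_PiE) auto
    have "v Q \<in> PiE ?I (\<lambda>_. UNIV)" for Q
      unfolding v_def by (rule restrict_PiE_iff[THEN iffD2]) simp
    hence "card (polys_below ?d :: 'a poly set) \<le> card (PiE ?I (\<lambda>_. UNIV :: 'a set))"
      using inj fin by (intro card_inj_on_le) auto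
    hence "CARD('a) ^ (r * n + 1) \<le> CARD('a) ^ (r * n)"
      by (simp only: card_polys_below) (simp add: card_PiE)
    thus False using card_field_ge_2[where 'a = 'a] by simp
  qed
  then obtain P Q where PQ: "P \<in> polys_below ?d" "Q \<in> polys_below ?d" "v P = v Q" "P \<noteq> Q"
    by (auto simp: inj_on_def)
  have "cancels r \<alpha> n (P - Q)"
    unfolding cancels_def
  proof (intro ballI)
    fix i k assume "i \<in> {1..r}" "k \<in> {1..n}"
    thus "fls_nth (poly_in_t (P - Q) * \<alpha> i) (int k) = 0"
      using fun_cong[OF PQ(3), of "(i, k)"] by (simp add: v_def poly_in_t_diff left_diff_distrib)
  qed
  moreover have "P - Q \<in> polys_below ?d" using PQ by (simp add: polys_below_def)
  ultimately show ?thesis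
    using PQ(4) polys_below_iff[of "P - Q" ?d] by (intro exI[of _ "P - Q"]) auto
qed

lemma min_length_le:
  fixes \<alpha> :: "nat \<Rightarrow> 'a::field fls"
  assumes "Q \<noteq> 0" "cancels r \<alpha> n Q"
  shows "min_length r \<alpha> n \<le> poly_length Q"
  unfolding min_length_altdef using assms by (intro Least_le) blast

text \<open>
  A best polynomial exists and is unique: two distinct monic admissible polynomials of the same
  minimal degree would have a non-zero admissible difference of smaller degree.
\<close>

definition best_poly :: "nat \<Rightarrow> (nat \<Rightarrow> 'a::field fls) \<Rightarrow> nat \<Rightarrow> 'a poly \<Rightarrow> bool" where
  "best_poly r \<alpha> n Q \<longleftrightarrow>
     lead_coeff Q = 1 \<and> cancels r \<alpha> n Q \<and> poly_length Q = min_length r \<alpha> n"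

lemma ex_best_poly:
  fixes \<alpha> :: "nat \<Rightarrow> 'a::{field,finite} fls"
  shows "\<exists>Q. best_poly r \<alpha> n Q"
proof -
  have "\<exists>d Q. Q \<noteq> 0 \<and> cancels r \<alpha> n Q \<and> d = poly_length Q"
    using ex_cancels[of r \<alpha> n] by blast
  from LeastI_ex[OF this] obtain Q where
    Q: "Q \<noteq> 0" "cancels r \<alpha> n Q" "poly_length Q = min_length r \<alpha> n"
    unfolding min_length_altdef by auto
  let ?Q = "smult (inverse (lead_coeff Q)) Q"
  have "best_poly r \<alpha> n ?Q"
    using Q unfolding best_poly_def by (auto simp: cancels_smult poly_length_def)
  thus ?thesis by blast
qed

lemma best_poly_unique:
  assumes "best_poly r \<alpha> n P" "best_poly r \<alpha> n Q"
  shows "P = Q"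
proof (rule ccontr)
  assume ne: "P \<noteq> Q"
  have deg: "degree P = degree Q" using assms by (simp add: best_poly_def poly_length_def)
  have "coeff (P - Q) (degree Q) = 0" using assms deg by (simp add: best_poly_def)
  moreover have "degree (P - Q) \<le> degree Q" using deg by (intro degree_diff_le) auto
  ultimately have "degree (P - Q) < degree Q"
    using ne by (metis le_neq_implies_less leading_coeff_0_iff right_minus_eq)
  moreover have "min_length r \<alpha> n \<le> poly_length (P - Q)"
    using assms ne by (intro min_length_le cancels_diff) (auto simp: best_poly_def)
  ultimately show False using assms(2) by (simp add: best_poly_def poly_length_def)
qed

lemma min_length_le_linear:
  fixes \<alpha> :: "nat \<Rightarrow> 'a::{field,finite} fls"
  shows "min_length r \<alpha> n \<le> r * n + 1"
proof -
  obtain Q where Q: "Q \<noteq> 0" "cancels r \<alpha> n Q" "poly_length Q \<le> r * n + 1"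
    using ex_cancels[of r \<alpha> n] by blast
  from min_length_le[OF Q(1,2)] Q(3) show ?thesis by (rule order_trans)
qed

lemma min_length_mono:
  fixes \<alpha> :: "nat \<Rightarrow> 'a::{field,finite} fls"
  shows "mono (min_length r \<alpha>)"
proof (rule monoI)
  fix m n :: nat assume "m \<le> n"
  obtain Q where Q: "best_poly r \<alpha> n Q" using ex_best_poly by blast
  hence "Q \<noteq> 0" "cancels r \<alpha> m Q"
    using \<open>m \<le> n\<close> cancels_mono by (auto simp: best_poly_def)
  from min_length_le[OF this] Q show "min_length r \<alpha> m \<le> min_length r \<alpha> n"
    by (simp add: best_poly_def)
qed

text \<open>
  If the minimal length does not grow from \<open>n\<close> to \<open>n + 1\<close>, then a best polynomial for \<open>n + 1\<close>
  is also one for \<open>n\<close>, hence equal to \<open>Q\<close> by uniqueness.  So stagnation is decided by the single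
  polynomial \<open>Q\<close>, and by one new coefficient in each coordinate.
\<close>

lemma min_length_Suc_eq_iff:
  fixes \<alpha> :: "nat \<Rightarrow> 'a::{field,finite} fls"
  assumes Q: "best_poly r \<alpha> n Q"
  shows "min_length r \<alpha> (Suc n) = min_length r \<alpha> n \<longleftrightarrow>
     (\<forall>i\<in>{1..r}. \<forall>k\<in>{n+1..n+1}. fls_nth (poly_in_t Q * \<alpha> i) (int k) = 0)"
    (is "_ \<longleftrightarrow> ?c")
proof -
  have *: "?c \<longleftrightarrow> cancels r \<alpha> (Suc n) Q"
    using Q by (auto simp: best_poly_def cancels_Suc)
  have "min_length r \<alpha> n \<le> min_length r \<alpha> (Suc n)"
    by (rule monoD[OF min_length_mono]) simp
  moreover have "min_length r \<alpha> (Suc n) \<le> min_length r \<alpha> n" if "cancels r \<alpha> (Suc n) Q"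
    using min_length_le[OF _ that] Q by (fastforce simp: best_poly_def)
  moreover have "cancels r \<alpha> (Suc n) Q" if eq: "min_length r \<alpha> (Suc n) = min_length r \<alpha> n"
  proof -
    obtain P where P: "best_poly r \<alpha> (Suc n) P" using ex_best_poly by blast
    hence "best_poly r \<alpha> n P" using eq by (auto simp: best_poly_def cancels_Suc)
    hence "P = Q" using Q by (rule best_poly_unique)
    with P show ?thesis by (simp add: best_poly_def)
  qed
  ultimately show ?thesis unfolding * by (meson le_antisym)
qed

text \<open>
  The first \<open>n\<close> coefficients of \<open>Q * \<alpha>\<close> involve only the coefficients of \<open>\<alpha>\<close> at indices below
  \<open>n + poly_length Q\<close>.  Consequently the lengths up to stage \<open>n\<close>, and the best polynomial \<open>Q\<close> at
  stage \<open>n\<close>, are functions of these coefficients alone, while coefficient \<open>n + 1\<close> of \<open>Q * \<alpha>\<close>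
  also involves the next, still unused, coefficient of \<open>\<alpha>\<close>, multiplied by the leading
  coefficient of \<open>Q\<close>.
\<close>

definition agree_below :: "nat \<Rightarrow> nat \<Rightarrow> (nat \<Rightarrow> 'a::zero fls) \<Rightarrow> (nat \<Rightarrow> 'a fls) \<Rightarrow> bool" where
  "agree_below r N \<alpha> \<beta> \<longleftrightarrow> (\<forall>i\<in>{1..r}. \<forall>k<int N. fls_nth (\<alpha> i) k = fls_nth (\<beta> i) k)"

lemma agree_below_sym: "agree_below r N \<alpha> \<beta> \<Longrightarrow> agree_below r N \<beta> \<alpha>"
  by (auto simp: agree_below_def)

lemma cancels_agree:
  assumes "agree_below r (n + d) \<alpha> \<beta>" "poly_length Q \<le> d"
  shows "cancels r \<alpha> n Q \<longleftrightarrow> cancels r \<beta> n Q"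
proof -
  have "fls_nth (poly_in_t Q * \<alpha> i) (int k) = fls_nth (poly_in_t Q * \<beta> i) (int k)"
    if "i \<in> {1..r}" "k \<in> {1..n}" for i k
    unfolding nth_poly_in_t_mult
  proof (intro sum.cong refl)
    fix m assume "m \<in> {..degree Q}"
    hence "int k + int m < int (n + d)" using that assms(2) by (auto simp: poly_length_def)
    thus "coeff Q m * fls_nth (\<alpha> i) (int k + int m) = coeff Q m * fls_nth (\<beta> i) (int k + int m)"
      using assms(1) that by (auto simp: agree_below_def)
  qed
  thus ?thesis by (auto simp: cancels_def)
qed

lemma min_length_agree_le:
  fixes \<alpha> :: "nat \<Rightarrow> 'a::{field,finite} fls"
  assumes "agree_below r (n + d) \<alpha> \<beta>" "min_length r \<alpha> n \<le> d"
  shows "min_length r \<beta> n \<le> min_length r \<alpha> n"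
proof -
  obtain Q where Q: "best_poly r \<alpha> n Q" using ex_best_poly by blast
  hence "poly_length Q \<le> d" using assms by (simp add: best_poly_def)
  with Q have "cancels r \<beta> n Q" "Q \<noteq> 0"
    using cancels_agree[OF assms(1)] by (auto simp: best_poly_def)
  from min_length_le[OF this(2,1)] Q show ?thesis by (simp add: best_poly_def)
qed

lemma min_length_agree:
  fixes \<alpha> :: "nat \<Rightarrow> 'a::{field,finite} fls"
  assumes "agree_below r (n + d) \<alpha> \<beta>" "min_length r \<alpha> n \<le> d"
  shows "min_length r \<beta> n = min_length r \<alpha> n"
proof (rule antisym)
  show le: "min_length r \<beta> n \<le> min_length r \<alpha> n" by (rule min_length_agree_le[OF assms])
  show "min_length r \<alpha> n \<le> min_length r \<beta> n"
    using le assms by (intro min_length_agree_le[OF agree_below_sym[OF assms(1)]]) simp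
qed

lemma best_poly_agree:
  fixes \<alpha> :: "nat \<Rightarrow> 'a::{field,finite} fls"
  assumes "best_poly r \<alpha> n Q" "agree_below r (n + poly_length Q) \<alpha> \<beta>"
  shows "best_poly r \<beta> n Q" and "\<And>m. m \<le> n \<Longrightarrow> min_length r \<beta> m = min_length r \<alpha> m"
proof -
  show *: "min_length r \<beta> m = min_length r \<alpha> m" if "m \<le> n" for m
  proof (rule min_length_agree)
    show "agree_below r (m + poly_length Q) \<alpha> \<beta>"
      using assms(2) that by (auto simp: agree_below_def)
    show "min_length r \<alpha> m \<le> poly_length Q"
      using assms(1) that min_length_mono[of r \<alpha>] by (auto simp: best_poly_def mono_def)
  qed
  show "best_poly r \<beta> n Q"
    using assms(1) *[of n] cancels_agree[OF assms(2) order_refl] by (auto simp: best_poly_def)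
qed

section \<open>The strong law for independent events of equal probability\<close>

context prob_space
begin

lemma indep_vars_indicator:
  assumes "indep_events E I"
  shows "indep_vars (\<lambda>_. borel) (\<lambda>i. indicator (E i) :: 'a \<Rightarrow> real) I"
proof -
  have E: "E i \<in> events" if "i \<in> I" for i
    using assms that by (auto simp: indep_events_def)
  have "indep_sets (\<lambda>i. sigma_sets (space M) {E i}) I"
    using assms unfolding indep_events_def_alt
    by (rule indep_sets_sigma) (auto simp: Int_stable_def)
  moreover have "indicator (E i) -` B \<inter> space M \<in> sigma_sets (space M) {E i}"
    if "i \<in> I" for i and B :: "real set"
  proof -
    interpret S: sigma_algebra "space M" "sigma_sets (space M) {E i}"
      using E[OF that] sets.sets_into_space by (intro sigma_algebra_sigma_sets) auto
    have in': "E i \<in> sigma_sets (space M) {E i}" by auto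
    have "indicator (E i) -` B \<inter> space M =
      (if 1 \<in> B then E i else {}) \<union> (if 0 \<in> B then space M - E i else {})"
      using sets.sets_into_space[OF E[OF that]]
      by (auto simp: indicator_def of_bool_def split: if_splits)
    also have "\<dots> \<in> sigma_sets (space M) {E i}"
      using in' by auto
    finally show ?thesis .
  qed
  hence "indep_sets (\<lambda>i. {indicator (E i) -` B \<inter> space M | B. B \<in> sets (borel :: real measure)}) I"
    by (intro indep_sets_mono_sets[OF calculation]) auto
  ultimately show ?thesis
    unfolding indep_vars_def2 using E by auto
qed

text \<open>
  Hoeffding's inequality bounds the probability of a deviation of the frequency by \<open>\<epsilon>\<close> after
  \<open>N\<close> trials by a geometric sequence in \<open>N\<close>, so Borel and Cantelli apply to each \<open>\<epsilon>\<close> from a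
  sequence tending to 0.
\<close>

lemma strong_law_indep_events:
  assumes indep: "indep_events E (UNIV :: nat set)" and p: "\<And>n. prob (E n) = p"
  shows "AE x in M. (\<lambda>N. real (card {n. n < N \<and> x \<in> E n}) / real N) \<longlonglongrightarrow> p"
proof -
  let ?X = "\<lambda>n. indicator (E n) :: 'a \<Rightarrow> real"
  have E [measurable]: "E n \<in> events" for n
    using indep by (auto simp: indep_events_def)
  have sum_X: "(\<Sum>n<N. ?X n x) = real (card {n. n < N \<and> x \<in> E n})" for N x
  proof -
    have "(\<Sum>n<N. ?X n x) = (\<Sum>n\<in>{n. n < N \<and> x \<in> E n}. 1)"
      by (intro sum.mono_neutral_cong_right) (auto simp: indicator_def)
    thus ?thesis by simp
  qed
  \<comment> \<open>The condition \<open>N > 0\<close> makes the geometric bound below true also for \<open>N = 0\<close>.\<close>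
  define A where "A = (\<lambda>(\<epsilon>::real) N. {x\<in>space M. \<bar>(\<Sum>n<N. ?X n x) - real N * p\<bar> \<ge> \<epsilon> * real N \<and> N > 0})"
  have A_bound: "prob (A \<epsilon> N) \<le> 2 * exp (-2 * \<epsilon>\<^sup>2) ^ N" if "\<epsilon> > 0" for \<epsilon> N
  proof (cases "N = 0")
    case False
    interpret Hoeffding_ineq M "{..<N}" ?X "\<lambda>_. 0" "\<lambda>_. 1" "\<Sum>n<N. expectation (?X n)"
    proof unfold_locales
      show "indep_vars (\<lambda>_. borel) ?X {..<N}"
        by (rule indep_vars_indicator) (use indep in \<open>auto simp: indep_events_def\<close>)
    qed (auto simp: indicator_def)
    have "prob (A \<epsilon> N) \<le> 2 * exp (-2 * (\<epsilon> * real N)\<^sup>2 / (\<Sum>i<N. (1 - 0)\<^sup>2))"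
      using Hoeffding_ineq_abs_ge[of "\<epsilon> * real N"] that False
      by (simp add: A_def p)
    also have "-2 * (\<epsilon> * real N)\<^sup>2 / (\<Sum>i<N. (1 - 0)\<^sup>2) = real N * (-2 * \<epsilon>\<^sup>2)"
      using False by (simp add: power2_eq_square)
    finally show ?thesis by (simp only: exp_of_nat_mult)
  qed (simp add: A_def)
  have "AE x in M. eventually (\<lambda>N. x \<in> space M - A (inverse (real (Suc m))) N) sequentially" for m
  proof (rule borel_cantelli_AE1)
    let ?\<epsilon> = "inverse (real (Suc m))"
    show "summable (\<lambda>N. prob (A ?\<epsilon> N))"
    proof (rule summable_comparison_test')
      show "summable (\<lambda>N. 2 * exp (-2 * ?\<epsilon>\<^sup>2) ^ N)"
        by (intro summable_mult summable_geometric) simp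
      show "norm (prob (A ?\<epsilon> N)) \<le> 2 * exp (-2 * ?\<epsilon>\<^sup>2) ^ N" for N
        using A_bound[of ?\<epsilon> N] by simp
    qed
  qed (auto simp: A_def emeasure_eq_measure)
  hence "AE x in M. \<forall>m. eventually (\<lambda>N. x \<in> space M - A (inverse (real (Suc m))) N) sequentially"
    by (simp add: AE_all_countable)
  thus ?thesis
  proof eventually_elim
    case (elim x)
    show ?case
    proof (rule LIMSEQ_I)
      fix \<epsilon> :: real assume "\<epsilon> > 0"
      then obtain m where m: "inverse (real (Suc m)) < \<epsilon>" using reals_Archimedean by blast
      from elim obtain N0 where N0: "\<And>N. N \<ge> N0 \<Longrightarrow> x \<in> space M - A (inverse (real (Suc m))) N"
        by (auto simp: eventually_sequentially)
      have "norm (real (card {n. n < N \<and> x \<in> E n}) / real N - p) < \<epsilon>" if "N \<ge> Suc N0" for N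
      proof -
        have "N > 0" using that by simp
        hence "\<bar>real (card {n. n < N \<and> x \<in> E n}) - real N * p\<bar> < inverse (real (Suc m)) * real N"
          using N0[of N] that by (auto simp: A_def sum_X)
        hence "\<bar>real (card {n. n < N \<and> x \<in> E n}) - real N * p\<bar> / real N < inverse (real (Suc m))"
          using \<open>N > 0\<close> by (simp add: divide_less_eq)
        also have "\<bar>real (card {n. n < N \<and> x \<in> E n}) - real N * p\<bar> / real N
                    = \<bar>real (card {n. n < N \<and> x \<in> E n}) / real N - p\<bar>"
          using \<open>N > 0\<close> by (simp add: field_simps abs_if)
        finally show ?thesis using m by simp
      qed
      thus "\<exists>N0. \<forall>N\<ge>N0. norm (real (card {n. n < N \<and> x \<in> E n}) / real N - p) < \<epsilon>" by blast
    qed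
  qed
qed

end

section \<open>The product Haar measure\<close>

text \<open>
  Two series agree in all coefficients below \<open>N\<close> as soon as their distance is below \<open>2 ^ (-N)\<close>,
  so a function of these coefficients is locally constant.
\<close>

lemma measurable_of_finitely_many_coefficients:
  fixes f :: "'a::field fls \<Rightarrow> 'b"
  assumes "\<And>x y. (\<And>k. k < int N \<Longrightarrow> fls_nth x k = fls_nth y k) \<Longrightarrow> f x = f y"
  shows "f \<in> borel \<rightarrow>\<^sub>M count_space UNIV"
proof -
  have "open (f -` S)" for S
  proof (rule openI)
    fix x assume x: "x \<in> f -` S"
    have eq: "f y = f x" if y: "dist x y < inverse (2 ^ N)" for y
    proof (rule assms)
      fix k assume k: "k < int N"
      show "fls_nth y k = fls_nth x k"
      proof (rule ccontr)
        assume ne: "fls_nth y k \<noteq> fls_nth x k"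
        let ?s = "fls_subdegree (x - y)"
        have s: "?s < int N" using ne k fls_subdegree_leI[of "x - y" k] by auto
        have "dist x y \<ge> inverse (2 ^ N)"
        proof (cases "?s \<ge> 0")
          case True
          hence "dist x y = inverse (2 ^ nat ?s)" using ne by (auto simp: dist_fls_def)
          moreover have "inverse (2 ^ N :: real) \<le> inverse (2 ^ nat ?s)"
            using s True by (intro le_imp_inverse_le power_increasing) auto
          ultimately show ?thesis by simp
        next
          case False
          hence "dist x y = 2 ^ nat (- ?s)" using ne by (auto simp: dist_fls_def)
          also have "\<dots> \<ge> (1::real)" by simp
          moreover have "inverse (2 ^ N :: real) \<le> 1" by (simp add: inverse_le_1_iff)
          ultimately show ?thesis by linarith
        qed
        with y show False by simp
      qed
    qed
    have "ball x (inverse (2 ^ N)) \<subseteq> f -` S"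
    proof
      fix y assume "y \<in> ball x (inverse (2 ^ N))"
      hence "f y = f x" by (intro eq) simp
      thus "y \<in> f -` S" using x by simp
    qed
    thus "\<exists>e>0. ball x e \<subseteq> f -` S"
      by (intro exI[of _ "inverse (2 ^ N)"]) simp
  qed
  thus ?thesis by (intro measurableI) (simp_all add: borel_open)
qed

locale haar_product =
  fixes \<mu> :: "'a::{field,finite} fls measure" and r :: nat
  assumes haar: "haar_probability fls_frac \<mu>"
begin

text \<open>This prevents the simplifier from rewriting the index set to \<open>{Suc 0..r}\<close>.\<close>

declare One_nat_def [simp del]

abbreviation P where "P \<equiv> (\<Pi>\<^sub>M i\<in>{1..r}. \<mu>)"

sublocale \<mu>: prob_space \<mu>
  using haar by (simp add: haar_probability_def)

sublocale product_prob_space "\<lambda>_. \<mu>" "{1..r}" by unfold_locales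

sublocale prob_space P by (intro prob_space_PiM \<mu>.prob_space_axioms)

lemma sets_\<mu>: "sets \<mu> = sets (restrict_space borel fls_frac)"
  using haar by (simp add: haar_probability_def)

lemma space_\<mu>: "space \<mu> = fls_frac"
  using sets_eq_imp_space_eq[OF sets_\<mu>] by (simp add: space_restrict_space)

lemma space_P: "space P = PiE {1..r} (\<lambda>_. fls_frac)"
  by (simp add: space_PiM space_\<mu>)

lemma fls_frac_add: "x \<in> fls_frac \<Longrightarrow> y \<in> fls_frac \<Longrightarrow> x + y \<in> (fls_frac :: 'a fls set)"
  by (simp add: mem_fls_frac_iff)

lemma measurable_shift_\<mu>: "x \<in> fls_frac \<Longrightarrow> (\<lambda>y. x + y) \<in> \<mu> \<rightarrow>\<^sub>M \<mu>"
proof -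
  assume x: "x \<in> fls_frac"
  have "continuous_on UNIV (\<lambda>y :: 'a fls. x + y)"
    by (intro continuous_onI) (auto simp: dist_fls_def)
  hence "(\<lambda>y. x + y) \<in> borel_measurable borel"
    by (rule borel_measurable_continuous_onI)
  hence "(\<lambda>y. x + y) \<in> restrict_space borel fls_frac \<rightarrow>\<^sub>M restrict_space borel fls_frac"
    using x by (intro measurable_restrict_space3) (auto intro: fls_frac_add)
  thus ?thesis by (simp add: measurable_cong_sets[OF sets_\<mu> sets_\<mu>])
qed

definition shift :: "(nat \<Rightarrow> 'a fls) \<Rightarrow> (nat \<Rightarrow> 'a fls) \<Rightarrow> nat \<Rightarrow> 'a fls" where
  "shift \<beta> \<alpha> = (\<lambda>i\<in>{1..r}. \<beta> i + \<alpha> i)"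

lemma shift_in_space:
  assumes "\<And>i. i \<in> {1..r} \<Longrightarrow> \<beta> i \<in> fls_frac" "\<alpha> \<in> space P"
  shows "shift \<beta> \<alpha> \<in> space P"
  using assms by (auto simp: space_P shift_def PiE_iff intro!: fls_frac_add)

lemma measurable_shift:
  assumes "\<And>i. i \<in> {1..r} \<Longrightarrow> \<beta> i \<in> fls_frac"
  shows "shift \<beta> \<in> P \<rightarrow>\<^sub>M P"
  unfolding shift_def
proof (rule measurable_restrict)
  fix i assume i: "i \<in> {1..r}"
  show "(\<lambda>\<alpha>. \<beta> i + \<alpha> i) \<in> P \<rightarrow>\<^sub>M \<mu>"
    using measurable_compose[OF measurable_component_singleton[OF i, of "\<lambda>_. \<mu>"]
        measurable_shift_\<mu>[OF assms[OF i]]] .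
qed

lemma distr_shift:
  assumes \<beta>: "\<And>i. i \<in> {1..r} \<Longrightarrow> \<beta> i \<in> fls_frac"
  shows "distr P P (shift \<beta>) = P"
proof (rule PiM_eqI)
  fix A assume A: "\<And>i. i \<in> {1..r} \<Longrightarrow> A i \<in> sets \<mu>"
  have pre: "(\<lambda>y. \<beta> i + y) -` A i \<inter> space \<mu> \<in> sets \<mu>" if "i \<in> {1..r}" for i
    using measurable_sets[OF measurable_shift_\<mu>[OF \<beta>[OF that]] A[OF that]] .
  have "shift \<beta> -` PiE {1..r} A \<inter> space P = PiE {1..r} (\<lambda>i. (\<lambda>y. \<beta> i + y) -` A i \<inter> space \<mu>)"
    by (auto simp: space_PiM shift_def PiE_iff)
  hence "emeasure (distr P P (shift \<beta>)) (PiE {1..r} A) =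
         emeasure P (PiE {1..r} (\<lambda>i. (\<lambda>y. \<beta> i + y) -` A i \<inter> space \<mu>))"
    using A by (subst emeasure_distr) (auto intro!: measurable_shift \<beta> sets_PiM_I_finite)
  also have "\<dots> = (\<Prod>i\<in>{1..r}. emeasure \<mu> ((\<lambda>y. \<beta> i + y) -` A i \<inter> space \<mu>))"
    using pre by (intro emeasure_PiM) auto
  also have "\<dots> = (\<Prod>i\<in>{1..r}. emeasure \<mu> (A i))"
  proof (intro prod.cong refl)
    fix i assume i: "i \<in> {1..r}"
    have "emeasure \<mu> (A i) = emeasure (distr \<mu> \<mu> (\<lambda>y. \<beta> i + y)) (A i)"
      using haar \<beta>[OF i] by (simp add: haar_probability_def)
    also have "\<dots> = emeasure \<mu> ((\<lambda>y. \<beta> i + y) -` A i \<inter> space \<mu>)"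
      by (rule emeasure_distr[OF measurable_shift_\<mu>[OF \<beta>[OF i]] A[OF i]])
    finally show "emeasure \<mu> ((\<lambda>y. \<beta> i + y) -` A i \<inter> space \<mu>) = emeasure \<mu> (A i)" ..
  qed
  finally show "emeasure (distr P P (shift \<beta>)) (PiE {1..r} A) = (\<Prod>i\<in>{1..r}. emeasure \<mu> (A i))" .
qed auto

lemma prob_shift:
  assumes "\<And>i. i \<in> {1..r} \<Longrightarrow> \<beta> i \<in> fls_frac" "A \<in> sets P"
  shows "prob (shift \<beta> -` A \<inter> space P) = prob A"
  using measure_distr[OF measurable_shift[OF assms(1)] assms(2)] distr_shift[OF assms(1)] by simp

lemma measurable_nth:
  assumes i: "i \<in> {1..r}"
  shows "(\<lambda>\<alpha>. fls_nth (poly_in_t Q * \<alpha> i) k) \<in> P \<rightarrow>\<^sub>M count_space UNIV"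
proof -
  have "(\<lambda>x :: 'a fls. fls_nth (poly_in_t Q * x) k) \<in> borel \<rightarrow>\<^sub>M count_space UNIV"
    by (rule measurable_of_finitely_many_coefficients[where N = "nat (k + int (degree Q) + 1)"])
       (auto simp: nth_poly_in_t_mult intro!: sum.cong)
  hence "(\<lambda>x :: 'a fls. fls_nth (poly_in_t Q * x) k) \<in> \<mu> \<rightarrow>\<^sub>M count_space UNIV"
    using measurable_restrict_space1 measurable_cong_sets[OF sets_\<mu> refl] by blast
  thus ?thesis
    using measurable_compose[OF measurable_component_singleton[OF i, of "\<lambda>_. \<mu>"]] by blast
qed

lemma pred_nth:
  assumes i: "i \<in> {1..r}"
  shows "Measurable.pred P (\<lambda>\<alpha>. fls_nth (poly_in_t Q * \<alpha> i) k = c)"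
  by (rule pred_count_space_const1[OF measurable_nth[OF i]])

lemma pred_ball_nth:
  "Measurable.pred P (\<lambda>\<alpha>. \<forall>i\<in>{1..r}. \<forall>k\<in>{m..n}. fls_nth (poly_in_t Q * \<alpha> i) (int k) = w (i, k))"
  by (intro pred_intros_finite(3) pred_nth) auto

lemma pred_cancels [measurable]: "Measurable.pred P (\<lambda>\<alpha>. cancels r \<alpha> n Q)"
  unfolding cancels_def by (rule pred_ball_nth[where w = "\<lambda>_. 0"])

lemma measurable_min_length [measurable]: "(\<lambda>\<alpha>. min_length r \<alpha> n) \<in> P \<rightarrow>\<^sub>M count_space UNIV"
proof -
  have eq: "(\<exists>Q. Q \<noteq> 0 \<and> cancels r \<alpha> n Q \<and> d = poly_length Q) \<longleftrightarrow>
        (\<exists>Q\<in>polys_below d. Q \<noteq> 0 \<and> cancels r \<alpha> n Q \<and> d = poly_length Q)"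
    for d and \<alpha> :: "nat \<Rightarrow> 'a fls"
    using polys_below_iff by blast
  have "Measurable.pred P (\<lambda>\<alpha>. \<exists>Q\<in>polys_below d. Q \<noteq> 0 \<and> cancels r \<alpha> n Q \<and> d = poly_length Q)" for d
    by (rule pred_intros_finite(4)[OF finite_polys_below]) measurable
  thus ?thesis
    unfolding min_length_altdef eq by (rule measurable_Least)
qed

lemma pred_best_poly [measurable]: "Measurable.pred P (\<lambda>\<alpha>. best_poly r \<alpha> n Q)"
  unfolding best_poly_def
  by measurable

text \<open>
  The source of all probabilities in the proof.  Any block of coefficients \<open>m, \<dots>, n\<close> of the
  \<open>Q * \<alpha> i\<close> can be turned into any other one by adding to \<open>\<alpha>\<close> suitable series \<open>V i / Q\<close>, whose
  coefficients below \<open>m + degree Q\<close> vanish.  The event \<open>A\<close> cannot see such a translation, and the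
  measure is translation invariant; so within \<open>A\<close> all the \<open>q ^ (r * (n + 1 - m))\<close> blocks are
  equally likely.
\<close>

lemma equidistribution:
  assumes A [measurable]: "A \<in> sets P" and Q: "Q \<noteq> 0" and m: "m \<ge> 1"
    and local: "\<And>\<alpha> \<beta>. \<alpha> \<in> A \<Longrightarrow> \<beta> \<in> space P \<Longrightarrow> agree_below r (m + degree Q) \<alpha> \<beta> \<Longrightarrow> \<beta> \<in> A"
  shows "prob {\<alpha>\<in>A. \<forall>i\<in>{1..r}. \<forall>k\<in>{m..n}. fls_nth (poly_in_t Q * \<alpha> i) (int k) = 0} =
           prob A / real (CARD('a)) ^ (r * (n + 1 - m))"
proof -
  define K where "K = {1..r} \<times> {m..n}"
  define W where "W = PiE K (\<lambda>_. UNIV :: 'a set)"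
  define v where "v = (\<lambda>\<alpha>. \<lambda>(i,k)\<in>K. fls_nth (poly_in_t Q * \<alpha> i) (int k))"
  define B where "B = (\<lambda>w. {\<alpha>\<in>A. \<forall>i\<in>{1..r}. \<forall>k\<in>{m..n}. fls_nth (poly_in_t Q * \<alpha> i) (int k) = w (i, k)})"
  have AP: "\<alpha> \<in> space P" if "\<alpha> \<in> A" for \<alpha>
    using that sets.sets_into_space[OF A] by blast
  have B_alt: "B w = A \<inter> {\<alpha>\<in>space P. \<forall>i\<in>{1..r}. \<forall>k\<in>{m..n}. fls_nth (poly_in_t Q * \<alpha> i) (int k) = w (i, k)}" for w
    using AP by (auto simp: B_def)
  have B_meas: "B w \<in> sets P" for w
    unfolding B_alt using pred_ball_nth by (intro sets.Int A) (simp add: pred_def)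
  have B_eq: "prob (B w) = prob (B (\<lambda>_. 0))" for w
  proof -
    define V where "V = (\<lambda>i. fps_to_fls (Abs_fps (\<lambda>k. if k \<in> {m..n} then w (i, k) else 0)))"
    have V: "fls_nth (V i) (int k) = w (i, k)" if "k \<in> {m..n}" for i k
      using that by (simp add: V_def)
    have "\<exists>b. poly_in_t Q * b = V i \<and> (\<forall>k < int (m + degree Q). fls_nth b k = 0)" for i
    proof -
      have "fls_nth (V i) k = 0" if "k < int m" for k
        using that by (auto simp: V_def)
      from ex_poly_in_t_mult_eq[OF Q this] show ?thesis by blast
    qed
    then obtain \<beta> where \<beta>: "\<And>i. poly_in_t Q * \<beta> i = V i"
        "\<And>i k. k < int (m + degree Q) \<Longrightarrow> fls_nth (\<beta> i) k = 0"
      by metis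
    have \<beta>_frac: "\<beta> i \<in> fls_frac" for i
      using \<beta>(2) m by (auto simp: mem_fls_frac_iff)
    have agree: "agree_below r (m + degree Q) \<alpha> (shift \<beta> \<alpha>)" for \<alpha>
      using \<beta>(2) by (auto simp: agree_below_def shift_def)
    have A_iff: "shift \<beta> \<alpha> \<in> A \<longleftrightarrow> \<alpha> \<in> A" if "\<alpha> \<in> space P" for \<alpha>
    proof
      show "\<alpha> \<in> A" if "shift \<beta> \<alpha> \<in> A"
        by (rule local[OF that \<open>\<alpha> \<in> space P\<close> agree_below_sym[OF agree]])
      show "shift \<beta> \<alpha> \<in> A" if "\<alpha> \<in> A"
        by (rule local[OF that shift_in_space[OF \<beta>_frac \<open>\<alpha> \<in> space P\<close>] agree])
    qed
    have coeff: "fls_nth (poly_in_t Q * shift \<beta> \<alpha> i) (int k) =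
        w (i, k) + fls_nth (poly_in_t Q * \<alpha> i) (int k)" if "i \<in> {1..r}" "k \<in> {m..n}" for \<alpha> i k
      using that \<beta>(1)[of i] V by (simp add: shift_def distrib_left)
    have "shift \<beta> -` B w \<inter> space P = B (\<lambda>_. 0)"
      using A_iff AP coeff by (auto simp: B_def)
    thus ?thesis using prob_shift[of \<beta> "B w", OF \<beta>_frac B_meas] by simp
  qed
  have finW: "finite W" unfolding W_def K_def by (intro finite_PiE) auto
  have cardW: "card W = CARD('a) ^ (r * (n + 1 - m))"
    by (simp add: W_def K_def card_PiE Suc_eq_plus1 del: power_mult)
  have disj: "disjoint_family_on B W"
    unfolding disjoint_family_on_def
  proof (intro ballI impI)
    fix w w' assume w: "w \<in> W" "w' \<in> W" "w \<noteq> w'"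
    then obtain z where "z \<in> K" "w z \<noteq> w' z" unfolding W_def by (meson PiE_ext)
    thus "B w \<inter> B w' = {}" by (auto simp: B_def K_def)
  qed
  have "A \<subseteq> (\<Union>w\<in>W. B w)"
  proof
    fix \<alpha> assume "\<alpha> \<in> A"
    hence "\<alpha> \<in> B (v \<alpha>)" "v \<alpha> \<in> W" by (auto simp: B_def v_def W_def K_def)
    thus "\<alpha> \<in> (\<Union>w\<in>W. B w)" by blast
  qed
  hence "A = (\<Union>w\<in>W. B w)" by (auto simp: B_def)
  hence "prob A = (\<Sum>w\<in>W. prob (B w))"
    using finite_measure_finite_Union[OF finW _ disj] B_meas by auto
  also have "\<dots> = (\<Sum>w\<in>W. prob (B (\<lambda>_. 0)))" by (intro sum.cong refl B_eq)
  finally show ?thesis by (simp add: cardW B_def field_simps)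
qed

definition stagnation :: "nat \<Rightarrow> (nat \<Rightarrow> 'a fls) set" where
  "stagnation n = {\<alpha>\<in>space P. min_length r \<alpha> (Suc n) = min_length r \<alpha> n}"

lemma stagnation_meas [measurable]: "stagnation n \<in> sets P"
  unfolding stagnation_def by measurable

text \<open>
  Stagnation at \<open>n\<close> has conditional probability \<open>q ^ (-r)\<close> given any event \<open>A\<close> that concerns
  only the lengths up to stage \<open>n\<close>.  For this \<open>A\<close> is split according to the best polynomial \<open>Q\<close>
  at stage \<open>n\<close>.  Each piece depends only on coefficients below
  \<open>n + poly_length Q = (n + 1) + degree Q\<close>, and stagnation means that coefficient \<open>n + 1\<close> of each
  of the \<open>r\<close> series \<open>Q * \<alpha> i\<close> vanishes, so equidistribution applies to each piece.
\<close>

lemma prob_history_stagnation: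
  assumes A [measurable]: "A \<in> sets P"
    and history: "\<And>\<alpha> \<beta>. \<alpha> \<in> A \<Longrightarrow> \<beta> \<in> space P \<Longrightarrow>
       (\<And>m. m \<le> n \<Longrightarrow> min_length r \<beta> m = min_length r \<alpha> m) \<Longrightarrow> \<beta> \<in> A"
  shows "prob (A \<inter> stagnation n) = prob A / real (CARD('a)) ^ r"
proof -
  define S where "S = {Q \<in> polys_below (r * n + 1). lead_coeff Q = (1 :: 'a)}"
  define C where "C = (\<lambda>Q. {\<alpha>\<in>A. best_poly r \<alpha> n Q})"
  have AP: "\<alpha> \<in> space P" if "\<alpha> \<in> A" for \<alpha>
    using that sets.sets_into_space[OF A] by blast
  have "C Q = A \<inter> {\<alpha>\<in>space P. best_poly r \<alpha> n Q}" for Q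
    using AP by (auto simp: C_def)
  hence C_meas [measurable]: "C Q \<in> sets P" for Q by simp
  have finS: "finite S" unfolding S_def using finite_polys_below by (rule finite_subset[rotated]) auto
  have union: "A = (\<Union>Q\<in>S. C Q)"
  proof (intro equalityI subsetI)
    fix \<alpha> assume \<alpha>: "\<alpha> \<in> A"
    obtain Q where Q: "best_poly r \<alpha> n Q" using ex_best_poly by blast
    have "Q \<noteq> 0" using Q by (auto simp: best_poly_def)
    hence "Q \<in> S"
      using Q min_length_le_linear[of r \<alpha> n] by (auto simp: S_def best_poly_def polys_below_iff)
    thus "\<alpha> \<in> (\<Union>Q\<in>S. C Q)" using \<alpha> Q by (auto simp: C_def)
  qed (auto simp: C_def)
  have disj: "disjoint_family_on C S"
    unfolding disjoint_family_on_def C_def using best_poly_unique by blast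
  have disj': "disjoint_family_on (\<lambda>Q. C Q \<inter> stagnation n) S"
    using disj unfolding disjoint_family_on_def by blast
  have step: "prob (C Q \<inter> stagnation n) = prob (C Q) / real (CARD('a)) ^ r" if "Q \<in> S" for Q
  proof -
    have eq: "C Q \<inter> stagnation n =
       {\<alpha>\<in>C Q. \<forall>i\<in>{1..r}. \<forall>k\<in>{n+1..n+1}. fls_nth (poly_in_t Q * \<alpha> i) (int k) = 0}"
    proof (rule set_eqI)
      fix \<alpha>
      show "\<alpha> \<in> C Q \<inter> stagnation n \<longleftrightarrow> \<alpha> \<in> {\<alpha>\<in>C Q. \<forall>i\<in>{1..r}. \<forall>k\<in>{n+1..n+1}.
              fls_nth (poly_in_t Q * \<alpha> i) (int k) = 0}"
        using AP[of \<alpha>] min_length_Suc_eq_iff[of r \<alpha> n Q]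
        unfolding C_def stagnation_def by blast
    qed
    have "prob (C Q \<inter> stagnation n) = prob (C Q) / real (CARD('a)) ^ (r * (n + 1 + 1 - (n + 1)))"
      unfolding eq
    proof (rule equidistribution)
      fix \<alpha> \<beta>
      assume *: "\<alpha> \<in> C Q" "\<beta> \<in> space P" "agree_below r (n + 1 + degree Q) \<alpha> \<beta>"
      hence "agree_below r (n + poly_length Q) \<alpha> \<beta>" by (simp add: poly_length_def ac_simps)
      note best = best_poly_agree[OF _ this]
      have \<alpha>: "\<alpha> \<in> A" "best_poly r \<alpha> n Q" using *(1) by (simp_all add: C_def)
      have "\<beta> \<in> A" by (rule history[OF \<alpha>(1) *(2) best(2)[OF \<alpha>(2)]])
      thus "\<beta> \<in> C Q" using best(1)[OF \<alpha>(2)] by (simp add: C_def)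
    qed (use that in \<open>auto simp: S_def\<close>)
    thus ?thesis by simp
  qed
  have "A \<inter> stagnation n = (\<Union>Q\<in>S. C Q \<inter> stagnation n)" using union by auto
  moreover have "(\<lambda>Q. C Q \<inter> stagnation n) ` S \<subseteq> sets P" by auto
  ultimately have "prob (A \<inter> stagnation n) = (\<Sum>Q\<in>S. prob (C Q \<inter> stagnation n))"
    using finite_measure_finite_Union[OF finS _ disj'] by metis
  also have "\<dots> = (\<Sum>Q\<in>S. prob (C Q)) / real (CARD('a)) ^ r"
    using step by (simp add: sum_divide_distrib)
  also have "(\<Sum>Q\<in>S. prob (C Q)) = prob (\<Union>Q\<in>S. C Q)"
    using C_meas by (intro finite_measure_finite_Union[symmetric] finS disj) auto
  also have "(\<Union>Q\<in>S. C Q) = A" using union ..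
  finally show ?thesis .
qed

lemma prob_space_P: "prob (space P) = 1"
  by (rule prob_space.prob_space[OF prob_space_PiM[OF \<mu>.prob_space_axioms]])

lemma prob_stagnation: "prob (stagnation n) = 1 / real (CARD('a)) ^ r"
proof -
  have "space P \<inter> stagnation n = stagnation n" by (auto simp: stagnation_def)
  thus ?thesis using prob_history_stagnation[of "space P" n] by (simp add: prob_space_P)
qed

text \<open>
  Product formula by induction, splitting off the largest index: the intersection of the
  earlier events is an event about the lengths up to stage \<open>n\<close>.
\<close>

lemma indep_stagnation: "indep_events stagnation UNIV"
proof (rule indep_eventsI)
  fix J :: "nat set" assume "finite J" "J \<noteq> {}"
  have "prob (space P \<inter> (\<Inter>n\<in>J. stagnation n)) = (\<Prod>n\<in>J. prob (stagnation n))"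
    using \<open>finite J\<close>
  proof (induction J rule: finite_linorder_max_induct)
    case empty
    show ?case by (simp add: prob_space_P)
  next
    case (insert n J)
    let ?A = "space P \<inter> (\<Inter>j\<in>J. stagnation j)"
    have "?A \<in> sets P"
      using insert.hyps(1) by (cases "J = {}") (auto intro!: sets.Int sets.finite_INT)
    moreover have "\<beta> \<in> ?A" if *: "\<alpha> \<in> ?A" "\<beta> \<in> space P"
      "\<And>m. m \<le> n \<Longrightarrow> min_length r \<beta> m = min_length r \<alpha> m" for \<alpha> \<beta>
    proof -
      have "min_length r \<beta> (Suc j) = min_length r \<beta> j" if j: "j \<in> J" for j
      proof -
        have "j < n" using insert.hyps(2) j by blast
        hence "min_length r \<beta> (Suc j) = min_length r \<alpha> (Suc j)"
          "min_length r \<beta> j = min_length r \<alpha> j"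
          by (auto intro: *(3))
        moreover have "\<alpha> \<in> stagnation j" using *(1) j by blast
        ultimately show ?thesis by (simp add: stagnation_def)
      qed
      thus ?thesis using *(2) by (auto simp: stagnation_def)
    qed
    ultimately have "prob (?A \<inter> stagnation n) = prob ?A / real (CARD('a)) ^ r"
      by (rule prob_history_stagnation)
    moreover have "?A \<inter> stagnation n = space P \<inter> (\<Inter>j\<in>insert n J. stagnation j)" by auto
    ultimately show ?case
      using insert by (auto simp: prob_stagnation)
  qed
  moreover have "space P \<inter> (\<Inter>n\<in>J. stagnation n) = (\<Inter>n\<in>J. stagnation n)"
    using \<open>J \<noteq> {}\<close> by (auto simp: stagnation_def)
  ultimately show "prob (\<Inter>n\<in>J. stagnation n) = (\<Prod>n\<in>J. prob (stagnation n))" by simp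
qed auto

lemma AE_stagnation_frequency:
  "AE \<alpha> in P. (\<lambda>N. real (card {n. n < N \<and> min_length r \<alpha> (Suc n) = min_length r \<alpha> n}) / real N)
     \<longlonglongrightarrow> 1 / real (CARD('a)) ^ r"
  using strong_law_indep_events[OF indep_stagnation prob_stagnation] AE_space
  by eventually_elim (simp add: stagnation_def)

end

section \<open>Growth of the minimal length\<close>

context haar_product
begin

lemma prob_cancels:
  assumes "Q \<noteq> 0"
  shows "prob {\<alpha>\<in>space P. cancels r \<alpha> N Q} = 1 / real (CARD('a)) ^ (r * N)"
  using equidistribution[of "space P" Q 1 N] assms by (simp add: cancels_def prob_space_P)

text \<open>
  Union bound: fewer than \<open>q ^ d\<close> non-zero polynomials have length at most \<open>d\<close>, and each is
  admissible at stage \<open>N\<close> with probability \<open>q ^ (- r * N)\<close>.  Here \<open>d\<close> is the largest length that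
  falls short of \<open>r * N\<close> by at least \<open>2 * log q (N + 1)\<close>.
\<close>

lemma prob_short_min_length:
  "prob {\<alpha>\<in>space P. real (CARD('a)) ^ min_length r \<alpha> N * real (Suc N) ^ 2 \<le> real (CARD('a)) ^ (r * N)}
     \<le> 1 / real (Suc N) ^ 2"
proof -
  let ?q = "real (CARD('a))"
  have q: "?q \<ge> 2" using card_field_ge_2[where 'a = 'a] by linarith
  define A where "A = {\<alpha>\<in>space P. ?q ^ min_length r \<alpha> N * real (Suc N) ^ 2 \<le> ?q ^ (r * N)}"
  define D where "D = {d. ?q ^ d * real (Suc N) ^ 2 \<le> ?q ^ (r * N)}"
  have finD: "finite D"
  proof (rule finite_subset)
    show "D \<subseteq> {..r * N}"
    proof
      fix d assume "d \<in> D"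
      have "?q ^ d * 1 \<le> ?q ^ d * real (Suc N) ^ 2"
        using q by (intro mult_left_mono) (auto simp: one_le_power)
      also have "\<dots> \<le> ?q ^ (r * N)" using \<open>d \<in> D\<close> by (simp add: D_def)
      finally show "d \<in> {..r * N}" using q by (simp add: power_increasing_iff)
    qed
  qed auto
  show ?thesis
  proof (cases "D = {}")
    case True
    hence "A = {}" by (auto simp: A_def D_def)
    hence "prob A = 0" by simp
    thus ?thesis unfolding A_def[symmetric] by simp
  next
    case False
    define d where "d = Max D"
    have d: "?q ^ d * real (Suc N) ^ 2 \<le> ?q ^ (r * N)"
      using Max_in[OF finD False] by (simp add: d_def D_def)
    define S where "S = polys_below d - {0 :: 'a poly}"
    have finS: "finite S" unfolding S_def using finite_polys_below by blast
    have "card S \<le> card (polys_below d :: 'a poly set)"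
      unfolding S_def by (intro card_mono finite_polys_below) auto
    hence "card S \<le> CARD('a) ^ d" by (simp only: card_polys_below)
    hence cardS: "real (card S) \<le> ?q ^ d"
      using of_nat_mono[of "card S" "CARD('a) ^ d", where 'a = real] by simp
    have "A \<subseteq> (\<Union>Q\<in>S. {\<alpha>\<in>space P. cancels r \<alpha> N Q})"
    proof
      fix \<alpha> assume \<alpha>: "\<alpha> \<in> A"
      obtain Q where Q: "best_poly r \<alpha> N Q" using ex_best_poly by blast
      have "min_length r \<alpha> N \<in> D" using \<alpha> by (simp add: A_def D_def)
      hence "min_length r \<alpha> N \<le> d" unfolding d_def using finD by (rule Max_ge[rotated])
      moreover have "Q \<noteq> 0" using Q by (auto simp: best_poly_def)
      ultimately have "Q \<in> S" using Q polys_below_iff[of Q d] by (simp add: S_def best_poly_def)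
      moreover have "cancels r \<alpha> N Q" using Q by (simp add: best_poly_def)
      ultimately show "\<alpha> \<in> (\<Union>Q\<in>S. {\<alpha>\<in>space P. cancels r \<alpha> N Q})"
        using \<alpha> by (auto simp: A_def)
    qed
    moreover have meas: "{\<alpha>\<in>space P. cancels r \<alpha> N Q} \<in> sets P" for Q by measurable
    ultimately have "prob A \<le> prob (\<Union>Q\<in>S. {\<alpha>\<in>space P. cancels r \<alpha> N Q})"
      using finS by (intro finite_measure_mono) auto
    also have "\<dots> \<le> (\<Sum>Q\<in>S. prob {\<alpha>\<in>space P. cancels r \<alpha> N Q})"
      using finS meas by (intro finite_measure_subadditive_finite) auto
    also have "\<dots> = real (card S) / ?q ^ (r * N)"
      using prob_cancels by (simp add: S_def)
    also have "\<dots> \<le> ?q ^ d / ?q ^ (r * N)" using cardS by (intro divide_right_mono) auto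
    also have "\<dots> \<le> 1 / real (Suc N) ^ 2"
      using d q by (simp add: divide_simps del: of_nat_Suc)
    finally show ?thesis unfolding A_def .
  qed
qed

text \<open>
  The upper bound \<open>r * N + 1\<close> always holds; by Borel and Cantelli the lower bound
  \<open>r * N - 2 * log q (N + 1)\<close> holds for all large \<open>N\<close>, almost everywhere.
\<close>

lemma AE_min_length_growth:
  "AE \<alpha> in P. (\<lambda>N. real (min_length r \<alpha> N) / real N) \<longlonglongrightarrow> real r"
proof -
  let ?q = "real (CARD('a))"
  have q: "?q \<ge> 2" using card_field_ge_2[where 'a = 'a] by linarith
  define A where "A = (\<lambda>N. {\<alpha>\<in>space P. ?q ^ min_length r \<alpha> N * real (Suc N) ^ 2 \<le> ?q ^ (r * N)})"
  have [measurable]: "A N \<in> sets P" for N unfolding A_def by measurable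
  have "summable (\<lambda>N. prob (A N))"
  proof (rule summable_comparison_test')
    have "summable (\<lambda>N. inverse (real (Suc N) ^ 2))"
      using inverse_power_summable[of 2, where 'a = real] by (subst summable_Suc_iff) auto
    thus "summable (\<lambda>N. 1 / real (Suc N) ^ 2)" by (simp add: inverse_eq_divide)
    show "norm (prob (A N)) \<le> 1 / real (Suc N) ^ 2" for N
      using prob_short_min_length[of N] by (simp add: A_def)
  qed
  hence "AE \<alpha> in P. eventually (\<lambda>N. \<alpha> \<in> space P - A N) sequentially"
    by (intro borel_cantelli_AE1) (auto simp: emeasure_eq_measure)
  thus ?thesis
  proof eventually_elim
    case (elim \<alpha>)
    let ?L = "min_length r \<alpha>"
    have lnq: "ln ?q > 0" using q by simp
    define c where "c = 2 / ln ?q"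
    show ?case
    proof (rule tendsto_sandwich)
      show "(\<lambda>N. real r - c * ln (real N + 1) / real N) \<longlonglongrightarrow> real r" by real_asymp
      show "(\<lambda>N. real r + 1 / real N) \<longlonglongrightarrow> real r" by real_asymp
      show "\<forall>\<^sub>F N in sequentially. real (?L N) / real N \<le> real r + 1 / real N"
        using eventually_gt_at_top[of 0]
      proof eventually_elim
        case (elim N)
        have "real (?L N) \<le> real (r * N + 1)"
          using min_length_le_linear by (intro of_nat_mono)
        thus ?case using elim by (simp add: field_simps)
      qed
      show "\<forall>\<^sub>F N in sequentially. real r - c * ln (real N + 1) / real N \<le> real (?L N) / real N"
        using elim eventually_gt_at_top[of 0]
      proof eventually_elim
        case (elim N)
        have "?q ^ (r * N) < ?q ^ ?L N * (real N + 1) ^ 2"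
          using elim(1) by (auto simp: A_def algebra_simps)
        hence "ln (?q ^ (r * N)) < ln (?q ^ ?L N * (real N + 1) ^ 2)"
          using q by (subst ln_less_cancel_iff) (auto intro!: mult_pos_pos)
        also have "\<dots> = real (?L N) * ln ?q + 2 * ln (real N + 1)"
          using q by (subst ln_mult) (auto simp: ln_realpow)
        finally have "real r * real N * ln ?q < real (?L N) * ln ?q + c * ln (real N + 1) * ln ?q"
          using q lnq by (simp add: ln_realpow c_def)
        hence "(real r * real N) * ln ?q < (real (?L N) + c * ln (real N + 1)) * ln ?q"
          by (simp only: distrib_right)
        hence "real r * real N < real (?L N) + c * ln (real N + 1)"
          using lnq by (simp only: mult_less_cancel_right_pos)
        hence "(real r * real N - c * ln (real N + 1)) / real N \<le> real (?L N) / real N"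
          by (intro divide_right_mono) auto
        thus ?case using elim(2) by (simp add: diff_divide_distrib)
      qed
    qed
  qed
qed

end

section \<open>Counting the distinct values of a monotone sequence\<close>

text \<open>The number of values below \<open>L N\<close> is the number of increases before \<open>N\<close>.\<close>

lemma enumerate_range_mono:
  fixes L :: "nat \<Rightarrow> nat"
  assumes "mono L" and inf: "infinite (range L)"
  shows "enumerate (range L) (card {n. n < N \<and> L (Suc n) \<noteq> L n}) = L N"
proof (induction N)
  case 0
  show ?case
    unfolding enumerate_0[simplified] using \<open>mono L\<close>
    by (auto simp: enumerate_0 mono_def intro!: Least_equality)
next
  case (Suc N)
  let ?J = "\<lambda>N. {n. n < N \<and> L (Suc n) \<noteq> L n}"
  show ?case
  proof (cases "L (Suc N) = L N")
    case True
    hence "?J (Suc N) = ?J N" by (auto simp: less_Suc_eq)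
    thus ?thesis using Suc True by simp
  next
    case False
    have lt: "L N < L (Suc N)" using False monoD[OF \<open>mono L\<close>, of N "Suc N"] by simp
    have "?J (Suc N) = insert N (?J N)" using False by (auto simp: less_Suc_eq)
    hence "card (?J (Suc N)) = Suc (card (?J N))" by simp
    hence "enumerate (range L) (card (?J (Suc N))) = (LEAST s. s \<in> range L \<and> L N < s)"
      using enumerate_Suc''[OF inf, of "card (?J N)"] Suc by simp
    also have "\<dots> = L (Suc N)"
    proof (rule Least_equality)
      fix y assume "y \<in> range L \<and> L N < y"
      then obtain k where k: "y = L k" "L N < L k" by blast
      hence "Suc N \<le> k" using monoD[OF \<open>mono L\<close>, of k N] by (meson not_less not_less_eq_eq)
      thus "L (Suc N) \<le> y" using monoD[OF \<open>mono L\<close>] k by blast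
    qed (use lt in auto)
    finally show ?thesis .
  qed
qed

lemma infinite_range_linear_growth:
  fixes L :: "nat \<Rightarrow> nat"
  assumes growth: "(\<lambda>N. real (L N) / real N) \<longlonglongrightarrow> a" and "a > 0"
  shows "infinite (range L)"
proof
  assume "finite (range L)"
  then obtain B where B: "\<And>N. L N \<le> B"
    by (meson finite_nat_set_iff_bounded_le rangeI)
  have "(\<lambda>N. real (L N) / real N) \<longlonglongrightarrow> 0"
  proof (rule tendsto_sandwich)
    show "\<forall>\<^sub>F N in sequentially. 0 \<le> real (L N) / real N" by simp
    show "(\<lambda>N. real B / real N) \<longlonglongrightarrow> 0" by real_asymp
    show "\<forall>\<^sub>F N in sequentially. real (L N) / real N \<le> real B / real N"
      using B by (intro always_eventually allI divide_right_mono) auto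
  qed auto
  with growth have "a = 0" by (rule LIMSEQ_unique)
  with \<open>a > 0\<close> show False by simp
qed

text \<open>
  Let \<open>J N\<close> be the number of increases before \<open>N\<close>, and \<open>M k\<close> a place where the \<open>k\<close>-th value
  (counted from 0) is taken.  Then \<open>J (M k) = k\<close>, and the \<open>k\<close>-th value divided by \<open>k\<close> is the
  quotient of \<open>L (M k) / M k\<close> and \<open>J (M k) / M k\<close>, whose limits are known.
\<close>

lemma enumerate_range_asymptotics:
  fixes L :: "nat \<Rightarrow> nat"
  assumes "mono L" and growth: "(\<lambda>N. real (L N) / real N) \<longlonglongrightarrow> a" and "a > 0"
    and freq: "(\<lambda>N. real (card {n. n < N \<and> L (Suc n) = L n}) / real N) \<longlonglongrightarrow> p" and "p < 1"
  shows "(\<lambda>j. real (enumerate (range L) (j - 1)) / real j) \<longlonglongrightarrow> a / (1 - p)"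
proof -
  define e where "e = enumerate (range L)"
  define J where "J = (\<lambda>N. card {n. n < N \<and> L (Suc n) \<noteq> L n})"
  have inf: "infinite (range L)" by (rule infinite_range_linear_growth) fact+
  have J_compl: "real (J N) = real N - real (card {n. n < N \<and> L (Suc n) = L n})" for N
  proof -
    have "{..<N} = {n. n < N \<and> L (Suc n) \<noteq> L n} \<union> {n. n < N \<and> L (Suc n) = L n}" by auto
    hence "N = card ({n. n < N \<and> L (Suc n) \<noteq> L n} \<union> {n. n < N \<and> L (Suc n) = L n})"
      by (metis card_lessThan)
    also have "\<dots> = J N + card {n. n < N \<and> L (Suc n) = L n}"
      unfolding J_def by (rule card_Un_disjoint) auto
    finally show ?thesis by linarith
  qed
  have J_lim: "(\<lambda>N. real (J N) / real N) \<longlonglongrightarrow> 1 - p"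
  proof (rule Lim_transform_eventually)
    show "(\<lambda>N. 1 - real (card {n. n < N \<and> L (Suc n) = L n}) / real N) \<longlonglongrightarrow> 1 - p"
      by (intro tendsto_intros freq)
    show "\<forall>\<^sub>F N in sequentially. 1 - real (card {n. n < N \<and> L (Suc n) = L n}) / real N = real (J N) / real N"
      using eventually_gt_at_top[of 0] by eventually_elim (simp add: J_compl diff_divide_distrib)
  qed
  have "\<exists>N. L N = e k \<and> J N = k" for k
  proof -
    have "e k \<in> range L" unfolding e_def by (rule enumerate_in_set[OF inf])
    then obtain N where N: "L N = e k" by auto
    hence "enumerate (range L) (J N) = enumerate (range L) k"
      using enumerate_range_mono[OF \<open>mono L\<close> inf, of N] by (simp add: J_def e_def)
    hence "J N = k" using inj_enumerate[OF inf] by (simp add: inj_eq)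
    with N show ?thesis by blast
  qed
  then obtain M where M: "\<And>k. L (M k) = e k" "\<And>k. J (M k) = k" by metis
  have "J N \<le> N" for N using J_compl[of N] by linarith
  hence "k \<le> M k" for k using M(2) by metis
  hence M_lim: "filterlim M at_top sequentially"
    by (intro filterlim_at_top_mono[OF filterlim_ident]) auto
  have "(\<lambda>k. (real (L (M k)) / real (M k)) / (real (J (M k)) / real (M k))) \<longlonglongrightarrow> a / (1 - p)"
    using \<open>p < 1\<close>
    by (intro tendsto_divide filterlim_compose[OF growth M_lim] filterlim_compose[OF J_lim M_lim]) auto
  moreover have "(real (L (M k)) / real (M k)) / (real (J (M k)) / real (M k)) = real (e k) / real k" for k
    using \<open>k \<le> M k\<close> M by (cases "k = 0") auto
  ultimately have e_lim: "(\<lambda>k. real (e k) / real k) \<longlonglongrightarrow> a / (1 - p)" by simp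
  have "(\<lambda>k. real k / real (Suc k)) \<longlonglongrightarrow> 1" by real_asymp
  from tendsto_mult[OF e_lim this]
  have "(\<lambda>k. real (e k) / real k * (real k / real (Suc k))) \<longlonglongrightarrow> a / (1 - p)"
    by (simp only: mult_1_right)
  hence "(\<lambda>k. real (e (Suc k - 1)) / real (Suc k)) \<longlonglongrightarrow> a / (1 - p)"
  proof (rule Lim_transform_eventually)
    show "\<forall>\<^sub>F k in sequentially. real (e k) / real k * (real k / real (Suc k))
            = real (e (Suc k - 1)) / real (Suc k)"
      using eventually_gt_at_top[of 0] by eventually_elim simp
  qed
  thus ?thesis unfolding e_def by (rule LIMSEQ_imp_Suc)
qed

text \<open>
  With \<open>K\<close> the number of terms up to \<open>D\<close> one has \<open>d K \<le> D < d (K + 1)\<close>, which encloses \<open>K / D\<close>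
  between two sequences in \<open>K\<close> with the same limit.
\<close>

lemma counting_function_asymptotics:
  fixes d :: "nat \<Rightarrow> nat"
  assumes strict: "\<And>i j. 1 \<le> i \<Longrightarrow> i < j \<Longrightarrow> d i < d j"
    and lim: "(\<lambda>j. real (d j) / real j) \<longlonglongrightarrow> c" and "c > 0"
  shows "((\<lambda>D::real. real (card {j. 1 \<le> j \<and> real (d j) \<le> D}) / D) \<longlongrightarrow> 1 / c) at_top"
proof -
  define K where "K = (\<lambda>D::real. card {j. 1 \<le> j \<and> real (d j) \<le> D})"
  have d_ge: "j \<le> Suc (d j)" for j
  proof (induction j)
    case (Suc j)
    thus ?case using strict[of j "Suc j"] by (cases "j = 0") auto
  qed auto
  have set_eq: "{j. 1 \<le> j \<and> real (d j) \<le> D} = {1..K D}" for D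
  proof -
    let ?S = "{j. 1 \<le> j \<and> real (d j) \<le> D}"
    have fin: "finite ?S"
    proof (rule finite_subset)
      show "?S \<subseteq> {..Suc (nat \<lfloor>D\<rfloor>)}"
      proof
        fix j assume "j \<in> ?S"
        hence "d j \<le> nat \<lfloor>D\<rfloor>" by (simp add: le_nat_floor)
        thus "j \<in> {..Suc (nat \<lfloor>D\<rfloor>)}" using d_ge[of j] by simp
      qed
    qed auto
    have down: "i \<in> ?S" if "j \<in> ?S" "1 \<le> i" "i \<le> j" for i j
      using that strict[of i j] by (cases "i = j") auto
    show ?thesis
    proof (cases "?S = {}")
      case False
      have eq: "?S = {1..Max ?S}"
      proof (intro equalityI subsetI)
        fix j assume "j \<in> {1..Max ?S}"
        thus "j \<in> ?S" by (intro down[OF Max_in[OF fin False]]) auto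
      next
        fix j assume j: "j \<in> ?S"
        hence "j \<le> Max ?S" by (rule Max_ge[OF fin])
        thus "j \<in> {1..Max ?S}" using j by simp
      qed
      have "K D = card {1..Max ?S}" unfolding K_def by (rule arg_cong[OF eq])
      hence "K D = Max ?S" by simp
      thus ?thesis using eq by (rule ssubst)
    next
      case True
      have "K D = 0" unfolding K_def True by simp
      thus ?thesis unfolding True by simp
    qed
  qed
  have K_lim: "filterlim K at_top at_top"
    unfolding filterlim_at_top
  proof
    fix Z
    show "\<forall>\<^sub>F D in at_top. Z \<le> K D"
      using eventually_ge_at_top[of "real (d (Suc Z))"]
    proof eventually_elim
      case (elim D)
      hence "Suc Z \<in> {1..K D}" unfolding set_eq[symmetric] by simp
      thus ?case by simp
    qed
  qed
  have low: "(\<lambda>k. real k / real (Suc k) * inverse (real (d (Suc k)) / real (Suc k))) \<longlonglongrightarrow> 1 * inverse c"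
  proof (intro tendsto_mult tendsto_inverse)
    show "(\<lambda>k. real k / real (Suc k)) \<longlonglongrightarrow> 1" by real_asymp
    show "(\<lambda>k. real (d (Suc k)) / real (Suc k)) \<longlonglongrightarrow> c" using LIMSEQ_Suc[OF lim] .
  qed (use \<open>c > 0\<close> in auto)
  have high: "(\<lambda>k. inverse (real (d k) / real k)) \<longlonglongrightarrow> inverse c"
    using \<open>c > 0\<close> by (intro tendsto_inverse lim) auto
  have "((\<lambda>D::real. real (K D) / D) \<longlongrightarrow> 1 / c) at_top"
  proof (rule tendsto_sandwich)
    show "((\<lambda>D. real (K D) / real (d (Suc (K D)))) \<longlongrightarrow> 1 / c) at_top"
      using filterlim_compose[OF low K_lim] by (simp add: field_simps del: of_nat_Suc)
    show "((\<lambda>D. real (K D) / real (d (K D))) \<longlongrightarrow> 1 / c) at_top"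
      using filterlim_compose[OF high K_lim] by (simp add: inverse_eq_divide)
    have ev: "\<forall>\<^sub>F D in at_top. K D \<ge> 2 \<and> D > 0"
      using K_lim unfolding filterlim_at_top by (intro eventually_conj eventually_gt_at_top) auto
    show "\<forall>\<^sub>F D in at_top. real (K D) / real (d (Suc (K D))) \<le> real (K D) / D"
      using ev
    proof eventually_elim
      case (elim D)
      have "Suc (K D) \<notin> {1..K D}" by simp
      hence "D < real (d (Suc (K D)))" unfolding set_eq[symmetric] by simp
      thus ?case using elim by (intro divide_left_mono) auto
    qed
    show "\<forall>\<^sub>F D in at_top. real (K D) / D \<le> real (K D) / real (d (K D))"
      using ev
    proof eventually_elim
      case (elim D)
      have "K D \<in> {1..K D}" using elim by simp
      hence "real (d (K D)) \<le> D" unfolding set_eq[symmetric] by simp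
      moreover have "d (K D) > 0" using strict[of 1 "K D"] elim by simp
      ultimately show ?case using elim by (intro divide_left_mono) auto
    qed
  qed
  thus ?thesis by (simp only: K_def)
qed

section \<open>The law of large numbers for the lengths\<close>

theorem theorem1p3:
  fixes \<mu> :: "'a::{field,finite} fls measure" and q r :: nat
  assumes "q = CARD('a)" and "r \<ge> 1"
    and "haar_probability fls_frac \<mu>"
  shows "(AE \<alpha> in (\<Pi>\<^sub>M i\<in>{1..r}. \<mu>).
            ((\<lambda>D::real. real (card {j. 1 \<le> j \<and> real (length_value r \<alpha> j) \<le> D}) / D)
               \<longlongrightarrow> (1 - 1 / real q ^ r) / real r) at_top) \<and>
         (AE \<alpha> in (\<Pi>\<^sub>M i\<in>{1..r}. \<mu>).
            (\<lambda>j. real (length_value r \<alpha> j) / real j) \<longlonglongrightarrow> real r / (1 - 1 / real q ^ r)) \<and>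
         real r / (1 - 1 / real q ^ r) = real r * real q ^ r / (real q ^ r - 1)"
proof -
  interpret haar_product \<mu> r by unfold_locales fact+
  have "2 \<le> q" using assms(1) card_field_ge_2[where 'a = 'a] by simp
  hence q: "real q > 1" by simp
  hence qr: "real q ^ r > 1" using \<open>r \<ge> 1\<close> by (intro one_less_power) auto
  hence p: "1 / real q ^ r < 1" using q by (subst divide_less_eq_1_pos) auto
  let ?c = "real r / (1 - 1 / real q ^ r)"
  have c: "?c > 0" 
    using \<open>r \<ge> 1\<close> p by (intro divide_pos_pos) linarith+
  have inf: "AE \<alpha> in P. infinite (range (min_length r \<alpha>))"
    using AE_min_length_growth
    by eventually_elim (rule infinite_range_linear_growth, use \<open>r \<ge> 1\<close> in auto)
  have lim: "AE \<alpha> in P. (\<lambda>j. real (length_value r \<alpha> j) / real j) \<longlonglongrightarrow> ?c"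
    using AE_min_length_growth AE_stagnation_frequency
  proof eventually_elim
    case (elim \<alpha>)
    thus ?case
      unfolding length_value_def using \<open>r \<ge> 1\<close> p assms(1)
      by (intro enumerate_range_asymptotics min_length_mono) auto
  qed
  have "AE \<alpha> in P. ((\<lambda>D::real. real (card {j. 1 \<le> j \<and> real (length_value r \<alpha> j) \<le> D}) / D)
               \<longlongrightarrow> 1 / ?c) at_top"
    using lim inf
  proof eventually_elim
    case (elim \<alpha>)
    have "length_value r \<alpha> i < length_value r \<alpha> j" if "1 \<le> i" "i < j" for i j
      unfolding length_value_def using that elim(2) by (intro enumerate_mono) auto
    thus ?case by (rule counting_function_asymptotics) (use elim(1) c in auto)
  qed
  hence "AE \<alpha> in P. ((\<lambda>D::real. real (card {j. 1 \<le> j \<and> real (length_value r \<alpha> j) \<le> D}) / D)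
               \<longlongrightarrow> (1 - 1 / real q ^ r) / real r) at_top" by simp
  moreover have "?c = real r * real q ^ r / (real q ^ r - 1)"
    using qr q by (simp add: field_simps)
  ultimately show ?thesis using lim by blast
qed

end
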